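(* Let $f_r^{(k)}(n)$ denote the maximum number of edges in a linear $k$-uniform hypergraph on $n$ vertices which contains no $r$-regular subhypergraph. For any $k\geq 2$ there are positive constants $C_0=C_0(k)$, $C_1=C_1(k)$, $C_2=C_2(k)$ such that for all integers $2\leq r\leq n$, $$C_0\, r^{\frac{1}{k-1}} n^{2-\frac{r}{(r-1)(k-1)}}\leq f_r^{(k)}(n)\leq C_1\, r^{\frac{1}{k-1}} n^{2-\frac{1}{k-1}}(\log n)^{C_2}.$$
   Context: A hypergraph is linear if any two distinct edges intersect in at most one vertex; $k$-uniform means all edges have size $k$. A non-empty hypergraph is $r$-regular if every vertex in it has degree $r$; a subhypergraph is given by a subset of the edges together with the vertices they cover. $\log$ is the natural logarithm.
   Formalization: The lower bound is stated only for n ≥ k: when n < k there are no edges of size k, so f_r^{(k)}(n) = 0 while the printed lower bound is positive (e.g. k = 3, r = n = 2); the upper bound is kept for all 2 ≤ r ≤ n. *)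

theory Defs
  imports Complex_Main
begin

definition uniform_hypergraph :: "nat \<Rightarrow> 'a set \<Rightarrow> 'a set set \<Rightarrow> bool" where
  "uniform_hypergraph k V E \<longleftrightarrow> (\<forall>e\<in>E. e \<subseteq> V \<and> card e = k)"

definition linear_hypergraph :: "'a set set \<Rightarrow> bool" where
  "linear_hypergraph E \<longleftrightarrow> (\<forall>e\<in>E. \<forall>e'\<in>E. e \<noteq> e' \<longrightarrow> card (e \<inter> e') \<le> 1)"

definition vertex_degree :: "'a set set \<Rightarrow> 'a \<Rightarrow> nat" where
  "vertex_degree E v = card {e \<in> E. v \<in> e}"

text \<open>A subhypergraph is determined by its edge set \<open>F\<close>; its vertex set is \<open>\<Union>F\<close>.\<close>

definition regular_hypergraph :: "nat \<Rightarrow> 'a set set \<Rightarrow> bool" where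
  "regular_hypergraph r F \<longleftrightarrow> F \<noteq> {} \<and> (\<forall>v\<in>\<Union>F. vertex_degree F v = r)"

definition has_regular_subhypergraph :: "nat \<Rightarrow> 'a set set \<Rightarrow> bool" where
  "has_regular_subhypergraph r E \<longleftrightarrow> (\<exists>F\<subseteq>E. regular_hypergraph r F)"

definition admissible_hypergraphs :: "nat \<Rightarrow> nat \<Rightarrow> nat \<Rightarrow> nat set set set" where
  "admissible_hypergraphs k r n =
     {E. uniform_hypergraph k {..<n} E \<and> linear_hypergraph E \<and> \<not> has_regular_subhypergraph r E}"

definition max_edges_no_regular :: "nat \<Rightarrow> nat \<Rightarrow> nat \<Rightarrow> nat" where
  "max_edges_no_regular k r n = Max (card ` admissible_hypergraphs k r n)"

text \<open>The maximum is attained: it is taken over a finite non-empty set.\<close>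

lemma finite_admissible_hypergraphs: "finite (admissible_hypergraphs k r n)"
proof (rule finite_subset)
  show "admissible_hypergraphs k r n \<subseteq> Pow (Pow {..<n})"
    by (auto simp: admissible_hypergraphs_def uniform_hypergraph_def)
qed simp

lemma empty_in_admissible_hypergraphs: "{} \<in> admissible_hypergraphs k r n"
  by (auto simp: admissible_hypergraphs_def uniform_hypergraph_def linear_hypergraph_def
      has_regular_subhypergraph_def regular_hypergraph_def)

end

theory Submission imports Defs "HOL-Library.FuncSet" "HOL-Library.Disjoint_Sets" begin

text \<open>
  Upper bound. Two disjoint matchings covering the same vertices form a 2-regular hypergraph, and more
  generally a sunflower with \<open>r\<close> petals among the matchings with a given vertex set yields an
  \<open>r\<close>-regular subhypergraph: remove the common kernel. A linear hypergraph with too many edges has, by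
  pigeonhole, so many matchings of some size \<open>m\<close> covering the same vertices that the sunflower lemma of
  Alweiss, Lovasz, Wu and Zhang (in the form \<open>(C r (log m)\<^sup>2)\<^sup>m\<close>) applies. Before counting, one passes to
  the edges whose largest vertex degree lies in a popular dyadic range: the distinguished vertices of
  maximum degree lie in a small set, which is what makes the pigeonhole efficient.

  Lower bound. Take a \<open>k\<close>-partite hypergraph with parts of size about \<open>n\<close>, except that the first is cut
  down to size \<open>a\<close>. The edges are indexed by almost all pairs from the first two parts and extended
  randomly to the other parts. An \<open>r\<close>-regular subhypergraph of it uses the same number \<open>m \<le> a\<close> of vertices
  in each part, and for the right \<open>a\<close> the union bound over such configurations converges geometrically.
\<close>

section \<open>Sunflowers\<close>

text \<open>The upper exponent comes from one comparison. On a dyadic level with \<open>e\<close>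
  edges and degrees below \<open>2 * q\<close>, greedy choice gives at least
  \<open>(e / 2) ^ m / fact m\<close> matchings for \<open>m\<close> of order \<open>e / q\<close>.
  Without an \<open>r\<close>-regular subhypergraph there are at most \<open>K ^ m\<close> of them
  per pair of vertex sets. Taking \<open>m\<close>-th roots leaves \<open>e * m ^ (k - 1)\<close> of
  order at most \<open>K * card V * n ^ (k - 1)\<close>. Since \<open>card V * q\<close> is bounded
  by a degree sum, \<open>e\<close> cancels, and \<open>q \<le> n\<close> gives
  \<open>e ^ (k - 1)\<close> of order \<open>n ^ (2 * k - 3)\<close> up to \<open>K\<close> and
  logarithms. A sunflower bound of factorial type would lose a power of \<open>m\<close> in the
  root; the base used here is linear in \<open>r\<close> and polylogarithmic, hence the factor
  \<open>r powr (1 / (k - 1))\<close>.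

  In the random construction the \<open>m\<close>-th root of the expected number of configurations
  is bounded by an increasing function of \<open>m\<close>, so large configurations are the
  obstacle. Narrowing one part to \<open>a\<close> caps \<open>m\<close> and costs only a factor in
  the number of edges. The balance is reached at \<open>a\<close> of order
  \<open>r powr \<beta> * s powr (1 - \<beta>)\<close> with
  \<open>\<beta> = r / ((r - 1) * (k - 1))\<close>, and \<open>a * s\<close> then has the exponent
  \<open>2 - \<beta>\<close>.\<close>

lemma sum_Pow_power_card:
  fixes a :: "'b :: comm_semiring_1"
  assumes "finite X"
  shows "(\<Sum>W\<in>Pow X. a ^ card (X - W)) = (1 + a) ^ card X"
  using assms
proof (induction X)
  case empty
  then show ?case by simp
next
  case (insert x X)
  have inj: "inj_on (insert x) (Pow X)"
    using insert.hyps by (auto simp: inj_on_def)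
  have disj: "Pow X \<inter> insert x ` Pow X = {}"
    using insert.hyps by auto
  have 1: "a ^ card (insert x X - W) = a * a ^ card (X - W)" if "W \<in> Pow X" for W
  proof -
    have "insert x X - W = insert x (X - W)" "x \<notin> X - W" using that insert.hyps by auto
    then show ?thesis using insert.hyps by simp
  qed
  have 2: "insert x X - insert x W = X - W" if "W \<in> Pow X" for W
    using that insert.hyps by auto
  have "(\<Sum>W\<in>Pow (insert x X). a ^ card (insert x X - W)) =
      (\<Sum>W\<in>Pow X. a ^ card (insert x X - W)) + (\<Sum>W\<in>insert x ` Pow X. a ^ card (insert x X - W))"
    unfolding Pow_insert by (rule sum.union_disjoint) (use insert.hyps disj in auto)
  also have "(\<Sum>W\<in>insert x ` Pow X. a ^ card (insert x X - W)) = (\<Sum>W\<in>Pow X. a ^ card (X - W))"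
    unfolding sum.reindex[OF inj] comp_def
  proof (rule sum.cong)
    fix W assume "W \<in> Pow X"
    then show "a ^ card (insert x X - insert x W) = a ^ card (X - W)" by (simp only: 2)
  qed simp
  also have "(\<Sum>W\<in>Pow X. a ^ card (insert x X - W)) = a * (\<Sum>W\<in>Pow X. a ^ card (X - W))"
    unfolding sum_distrib_left by (intro sum.cong refl 1)
  finally show ?case using insert by (simp add: algebra_simps)
qed

text \<open>Sorting colourings by the class \<open>W\<close> of the colour \<open>q\<close> lets a
  list of colours be processed one at a time. Points off \<open>W\<close> have
  \<open>card Q - 1\<close> colours left, which is the origin of the weights
  \<open>(M - 1) ^ card (X - W)\<close>.\<close>

lemma card_colourings_split:
  assumes X: "finite X" and Q: "finite Q" and q: "q \<in> Q"
  shows "card {c \<in> X \<rightarrow>\<^sub>E Q. P c} =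
    (\<Sum>W\<in>Pow X. card {c \<in> (X - W) \<rightarrow>\<^sub>E (Q - {q}). P (\<lambda>x\<in>X. if x \<in> W then q else c x)})"
proof -
  define A where "A W = {c \<in> (X - W) \<rightarrow>\<^sub>E (Q - {q}). P (\<lambda>x\<in>X. if x \<in> W then q else c x)}" for W
  define \<phi> where "\<phi> = (\<lambda>(W, c). (\<lambda>x\<in>X. if x \<in> W then q else c x))"
  have fin: "finite (A W)" for W
    unfolding A_def using X Q by (simp add: finite_PiE)
  have "bij_betw \<phi> (Sigma (Pow X) A) {c \<in> X \<rightarrow>\<^sub>E Q. P c}"
  proof (rule bij_betwI[where g = "\<lambda>c. ({x \<in> X. c x = q}, restrict c {x \<in> X. c x \<noteq> q})"])
    show "\<phi> \<in> Sigma (Pow X) A \<rightarrow> {c \<in> X \<rightarrow>\<^sub>E Q. P c}"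
      using q by (auto simp: \<phi>_def A_def PiE_def Pi_def split: if_splits)
    show "(\<lambda>c. ({x \<in> X. c x = q}, restrict c {x \<in> X. c x \<noteq> q})) \<in> {c \<in> X \<rightarrow>\<^sub>E Q. P c} \<rightarrow> Sigma (Pow X) A"
    proof
      fix c assume c: "c \<in> {c \<in> X \<rightarrow>\<^sub>E Q. P c}"
      have "(\<lambda>x\<in>X. if x \<in> {x \<in> X. c x = q} then q else restrict c {x \<in> X. c x \<noteq> q} x) = c"
        using c by (auto simp: fun_eq_iff PiE_def extensional_def)
      then show "({x \<in> X. c x = q}, restrict c {x \<in> X. c x \<noteq> q}) \<in> Sigma (Pow X) A"
        using c by (auto simp: A_def PiE_def Pi_def)
    qed
    show "({x \<in> X. \<phi> y x = q}, restrict (\<phi> y) {x \<in> X. \<phi> y x \<noteq> q}) = y"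
      if "y \<in> Sigma (Pow X) A" for y
    proof -
      obtain W c where y: "y = (W, c)" by force
      have W: "W \<subseteq> X" and c: "c \<in> (X - W) \<rightarrow>\<^sub>E (Q - {q})" using that y by (auto simp: A_def)
      have 1: "{x \<in> X. \<phi> y x = q} = W"
        using W c by (auto simp: \<phi>_def y)
      have "restrict (\<phi> y) {x \<in> X. \<phi> y x \<noteq> q} = c"
      proof
        fix x
        show "restrict (\<phi> y) {x \<in> X. \<phi> y x \<noteq> q} x = c x"
          using W c by (cases "x \<in> X - W") (auto simp: \<phi>_def y PiE_def extensional_def)
      qed
      then show ?thesis using 1 y by simp
    qed
    show "\<phi> ({x \<in> X. c x = q}, restrict c {x \<in> X. c x \<noteq> q}) = c" if "c \<in> {c \<in> X \<rightarrow>\<^sub>E Q. P c}" for c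
      using that by (auto simp: \<phi>_def fun_eq_iff PiE_def extensional_def)
  qed
  then have "card {c \<in> X \<rightarrow>\<^sub>E Q. P c} = card (Sigma (Pow X) A)"
    by (simp add: bij_betw_same_card)
  also have "\<dots> = (\<Sum>W\<in>Pow X. card (A W))"
    using X fin by (simp add: card_SigmaI)
  finally show ?thesis by (simp add: A_def)
qed

text \<open>
  The minimality of the residue \<open>C\<close> is what makes it recoverable: it is contained in every member of the
  family that lies in \<open>W \<union> C\<close>.
\<close>

lemma minimal_residue_exists:
  assumes fin: "\<And>j. j \<in> I \<Longrightarrow> finite (T j)" and i: "i \<in> I"
  shows "\<exists>C. C \<subseteq> T i - W \<and> (\<exists>j\<in>I. T j \<subseteq> W \<union> C) \<and> (\<forall>j\<in>I. T j \<subseteq> W \<union> C \<longrightarrow> C \<subseteq> T j)"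
proof -
  \<comment> \<open>The residue is \<open>T j - W\<close> for a member \<open>j\<close> inside
    \<open>T i \<union> W\<close> minimising its size. A member inside
    \<open>W \<union> (T j - W)\<close> satisfies \<open>P\<close> again, so minimality forces equal
    residues.\<close>
  define P where "P j \<longleftrightarrow> j \<in> I \<and> T j \<subseteq> T i \<union> W" for j
  have "P i" using i by (auto simp: P_def)
  then obtain j where j: "P j" and min: "\<And>j'. P j' \<Longrightarrow> card (T j - W) \<le> card (T j' - W)"
    using ex_has_least_nat[of P i "\<lambda>j. card (T j - W)"] by blast
  show ?thesis
  proof (intro exI[of _ "T j - W"] conjI ballI impI)
    fix j' assume j': "j' \<in> I" "T j' \<subseteq> W \<union> (T j - W)"
    then have "P j'" using j by (auto simp: P_def)
    then have "card (T j - W) \<le> card (T j' - W)" by (rule min)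
    moreover have "T j' - W \<subseteq> T j - W" using j' by auto
    moreover have "finite (T j - W)" using j fin by (auto simp: P_def)
    ultimately have "T j' - W = T j - W" by (metis card_seteq)
    then show "T j - W \<subseteq> T j'" by blast
  qed (use j in \<open>auto simp: P_def\<close>)
qed

text \<open>
  Weighted by \<open>(M - 1) ^ card (X - W)\<close>, the set \<open>W\<close> is up to scaling a random set of density \<open>1 / M\<close>. A bad
  pair \<open>(W, i)\<close> is encoded by \<open>Z = W \<union> \<chi> W i\<close>, the residue \<open>\<chi> W i\<close> and \<open>i\<close>; given \<open>Z\<close>, the residue is a
  subset of one canonical member inside \<open>Z\<close>, and given the residue, spreadness leaves few \<open>i\<close>.
\<close>

lemma bad_residues_bound:
  fixes M R N :: real and T :: "'i \<Rightarrow> 'x set"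
  assumes X: "finite X" and I: "finite I" and TX: "\<And>i. i \<in> I \<Longrightarrow> T i \<subseteq> X"
    and card_T: "\<And>i. i \<in> I \<Longrightarrow> card (T i) < 2 * s" and s: "s \<ge> 1"
    and spread: "\<And>A. A \<subseteq> X \<Longrightarrow> real (card {i \<in> I. A \<subseteq> T i}) * R ^ card A \<le> N"
    and \<chi>_sub: "\<And>W i. W \<subseteq> X \<Longrightarrow> i \<in> I \<Longrightarrow> \<chi> W i \<subseteq> T i - W"
    and \<chi>_ex: "\<And>W i. W \<subseteq> X \<Longrightarrow> i \<in> I \<Longrightarrow> \<exists>j\<in>I. T j \<subseteq> W \<union> \<chi> W i"
    and \<chi>_min: "\<And>W i j. W \<subseteq> X \<Longrightarrow> i \<in> I \<Longrightarrow> j \<in> I \<Longrightarrow> T j \<subseteq> W \<union> \<chi> W i \<Longrightarrow> \<chi> W i \<subseteq> T j"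
    and M: "M \<ge> 1" and R: "4 * M \<le> R"
  shows "(\<Sum>W\<in>Pow X. (M - 1) ^ card (X - W) * real (card {i \<in> I. s \<le> card (\<chi> W i)}))
    \<le> 4 * M / R * N * M ^ card X"
proof -
  \<comment> \<open>\<open>j Z\<close> is the canonical member inside \<open>Z\<close>, and
    \<open>A Z\<close> collects the candidates for the residue once \<open>Z\<close> is known. As
    \<open>card (T (j Z)) < 2 * s\<close>, there are at most \<open>4 ^ s\<close> of them.\<close>
  define j where "j Z = (SOME j. j \<in> I \<and> T j \<subseteq> Z)" for Z
  define A where "A Z = (if \<exists>j\<in>I. T j \<subseteq> Z then {C. C \<subseteq> T (j Z) \<and> s \<le> card C} else {})" for Z
  define B where "B W = {i \<in> I. s \<le> card (\<chi> W i)}" for W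
  have j: "j Z \<in> I \<and> T (j Z) \<subseteq> Z" if "\<exists>j\<in>I. T j \<subseteq> Z" for Z
    unfolding j_def by (rule someI_ex) (use that in blast)
  have N: "N \<ge> 0" using spread[of "{}"] by (smt (verit) empty_subsetI of_nat_0_le_iff card.empty power_0 mult_cancel_left2)
  have Rpos: "R > 0" using M R by linarith
  have finT: "finite (T i)" if "i \<in> I" for i using that TX X finite_subset by blast
  have A_sub: "A Z \<subseteq> Pow X" if "Z \<subseteq> X" for Z
  proof (cases "\<exists>j\<in>I. T j \<subseteq> Z")
    case True
    then have "T (j Z) \<subseteq> X" using j[of Z] TX by blast
    then show ?thesis unfolding A_def by auto
  qed (simp add: A_def)
  have finA: "finite (A Z)" if "Z \<subseteq> X" for Z
    using A_sub[OF that] X finite_subset by blast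
  have cardA: "real (card (A Z)) \<le> 4 ^ s" for Z
  proof (cases "\<exists>j\<in>I. T j \<subseteq> Z")
    case True
    have "card (A Z) \<le> card (Pow (T (j Z)))"
      using True j finT by (intro card_mono) (auto simp: A_def)
    also have "\<dots> = 2 ^ card (T (j Z))" using True j finT by (simp add: card_Pow)
    also have "\<dots> \<le> 2 ^ (2 * s)" using card_T True j by (intro power_increasing) (auto simp: less_imp_le)
    also have "\<dots> = 4 ^ s" by (simp add: power_mult)
    finally have "card (A Z) \<le> 4 ^ s" .
    then have "real (card (A Z)) \<le> real (4 ^ s)" by (rule of_nat_mono)
    then show ?thesis by simp
  qed (simp add: A_def)
  \<comment> \<open>The factor \<open>M ^ card C\<close> pays for passing from
    \<open>card (X - W)\<close> to \<open>card (X - Z)\<close> in the exponent of the weight.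
    Spreadness returns \<open>R ^ card C\<close>, and with \<open>s \<le> card C\<close> the gain is
    enough to absorb the \<open>4 ^ s\<close> candidates.\<close>
  have term_le: "real (card {i \<in> I. C \<subseteq> T i}) * M ^ card C \<le> N * (M / R) ^ s"
    if "C \<in> A Z" "Z \<subseteq> X" for C Z
  proof -
    have CX: "C \<subseteq> X" using that A_sub by blast
    have sC: "s \<le> card C" using that by (auto simp: A_def split: if_splits)
    have "real (card {i \<in> I. C \<subseteq> T i}) * M ^ card C =
        (real (card {i \<in> I. C \<subseteq> T i}) * R ^ card C) * (M / R) ^ card C"
      using Rpos by (simp add: power_divide)
    also have "\<dots> \<le> N * (M / R) ^ card C"
      using spread[OF CX] M Rpos by (intro mult_right_mono) auto
    also have "\<dots> \<le> N * (M / R) ^ s"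
      using N M R Rpos sC by (intro mult_left_mono power_decreasing) (auto simp: field_simps)
    finally show ?thesis .
  qed
  define G where "G = Sigma (Pow X) (\<lambda>Z. Sigma (A Z) (\<lambda>C. {i \<in> I. C \<subseteq> T i}))"
  define g where "g = (\<lambda>(Z, C, i::'i). (M - 1) ^ card (X - Z) * M ^ card (C :: 'x set))"
  define \<phi> where "\<phi> = (\<lambda>(W, i). (W \<union> \<chi> W i, \<chi> W i, i))"
  have finG: "finite G"
    unfolding G_def using X I finA by (intro finite_SigmaI) auto
  have inj: "inj_on \<phi> (Sigma (Pow X) B)"
  proof (rule inj_onI, clarify)
    fix W i W' i' assume *: "W \<subseteq> X" "W' \<subseteq> X" "i \<in> B W" "i' \<in> B W'" "\<phi> (W, i) = \<phi> (W', i')"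
    have "W = (W \<union> \<chi> W i) - \<chi> W i" "W' = (W' \<union> \<chi> W' i') - \<chi> W' i'"
      using \<chi>_sub * by (auto simp: B_def)
    then show "W = W' \<and> i = i'" using * unfolding \<phi>_def by auto
  qed
  have sub: "\<phi> ` Sigma (Pow X) B \<subseteq> G"
  proof (rule image_subsetI, clarify)
    fix W i assume *: "W \<subseteq> X" "i \<in> B W"
    then have i: "i \<in> I" "s \<le> card (\<chi> W i)" by (auto simp: B_def)
    have ex: "\<exists>j\<in>I. T j \<subseteq> W \<union> \<chi> W i" using \<chi>_ex * i by blast
    have "\<chi> W i \<subseteq> T (j (W \<union> \<chi> W i))"
      using j[OF ex] \<chi>_min * i by blast
    then have "\<chi> W i \<in> A (W \<union> \<chi> W i)" using ex i by (auto simp: A_def)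
    moreover have "\<chi> W i \<subseteq> T i" "W \<union> \<chi> W i \<subseteq> X"
      using \<chi>_sub[of W i] TX[of i] * i by blast+
    ultimately show "\<phi> (W, i) \<in> G"
      using i unfolding G_def \<phi>_def by simp
  qed
  have "(\<Sum>W\<in>Pow X. (M - 1) ^ card (X - W) * real (card (B W))) =
      (\<Sum>W\<in>Pow X. \<Sum>i\<in>B W. (M - 1) ^ card (X - W))"
    by (simp add: mult.commute)
  also have "\<dots> = (\<Sum>(W, i)\<in>Sigma (Pow X) B. (M - 1) ^ card (X - W))"
    using X I by (intro sum.Sigma) (auto simp: B_def)
  also have "\<dots> \<le> (\<Sum>x\<in>Sigma (Pow X) B. g (\<phi> x))"
  proof (rule sum_mono, clarify)
    fix W i assume *: "W \<subseteq> X" "i \<in> B W"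
    then have sub: "\<chi> W i \<subseteq> T i - W" "T i \<subseteq> X" using \<chi>_sub TX by (auto simp: B_def)
    then have "X - W = (X - (W \<union> \<chi> W i)) \<union> \<chi> W i" "(X - (W \<union> \<chi> W i)) \<inter> \<chi> W i = {}" by auto
    then have "card (X - W) = card (X - (W \<union> \<chi> W i)) + card (\<chi> W i)"
      using X sub by (metis card_Un_disjoint finite_Diff finite_subset)
    then show "(M - 1) ^ card (X - W) \<le> g (\<phi> (W, i))"
      unfolding g_def \<phi>_def using M by (auto simp: power_add intro!: mult_left_mono power_mono)
  qed
  also have "\<dots> = sum g (\<phi> ` Sigma (Pow X) B)"
    using sum.reindex[OF inj, of g] by simp
  also have "\<dots> \<le> sum g G"
    using M by (intro sum_mono2 finG sub) (auto simp: g_def)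
  also have "\<dots> = (\<Sum>Z\<in>Pow X. \<Sum>C\<in>A Z. \<Sum>i\<in>{i \<in> I. C \<subseteq> T i}. (M - 1) ^ card (X - Z) * M ^ card C)"
  proof -
    have "(\<Sum>Z\<in>Pow X. \<Sum>C\<in>A Z. \<Sum>i\<in>{i \<in> I. C \<subseteq> T i}. (M - 1) ^ card (X - Z) * M ^ card C) =
        (\<Sum>Z\<in>Pow X. \<Sum>(C, i)\<in>Sigma (A Z) (\<lambda>C. {i \<in> I. C \<subseteq> T i}). (M - 1) ^ card (X - Z) * M ^ card C)"
      using I finA by (intro sum.cong refl sum.Sigma) auto
    also have "\<dots> = sum g G"
      unfolding G_def g_def using X I finA by (subst sum.Sigma) (auto intro: finite_SigmaI)
    finally show ?thesis by simp
  qed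
  also have "\<dots> = (\<Sum>Z\<in>Pow X. (M - 1) ^ card (X - Z) * (\<Sum>C\<in>A Z. real (card {i \<in> I. C \<subseteq> T i}) * M ^ card C))"
    by (simp add: sum_distrib_left mult_ac)
  also have "\<dots> \<le> (\<Sum>Z\<in>Pow X. (M - 1) ^ card (X - Z) * (4 * M / R * N))"
  proof (intro sum_mono mult_left_mono)
    fix Z assume Z: "Z \<in> Pow X"
    have "(\<Sum>C\<in>A Z. real (card {i \<in> I. C \<subseteq> T i}) * M ^ card C) \<le> real (card (A Z)) * (N * (M / R) ^ s)"
      using term_le Z by (intro sum_bounded_above) auto
    also have "\<dots> \<le> 4 ^ s * (N * (M / R) ^ s)"
      using cardA N M Rpos by (intro mult_right_mono) auto
    also have "\<dots> = N * (4 * M / R) ^ s" by (simp add: power_divide power_mult_distrib)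
    also have "\<dots> \<le> N * (4 * M / R) ^ 1"
      using N M R Rpos s by (intro mult_left_mono power_decreasing) (auto simp: field_simps)
    finally show "(\<Sum>C\<in>A Z. real (card {i \<in> I. C \<subseteq> T i}) * M ^ card C) \<le> 4 * M / R * N"
      by (simp add: mult.commute)
  qed (use M in auto)
  also have "\<dots> = 4 * M / R * N * M ^ card X"
    using sum_Pow_power_card[OF X, of "M - 1"] unfolding sum_distrib_right[symmetric] by simp
  finally show ?thesis unfolding B_def .
qed

text \<open>
  Each colour class in turn at least halves the sizes of almost all surviving residues. Spreadness is
  measured against the fixed number \<open>N\<close>, so it is inherited when members are shrunk or dropped.
\<close>

lemma spread_family_colour_failures:
  fixes M R N :: real and T :: "'i \<Rightarrow> 'x set" and cs :: "'c list"
  assumes "finite X" "finite Q" "distinct cs" "set cs \<subseteq> Q" "finite I"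
    and "\<And>i. i \<in> I \<Longrightarrow> T i \<subseteq> X" "\<And>i. i \<in> I \<Longrightarrow> card (T i) < 2 ^ length cs"
    and "\<And>A. A \<subseteq> X \<Longrightarrow> real (card {i \<in> I. A \<subseteq> T i}) * R ^ card A \<le> N"
    and "real (card Q) \<le> M" "M \<ge> 1" "4 * M \<le> R"
  shows "real (card {c \<in> X \<rightarrow>\<^sub>E Q. \<forall>i\<in>I. \<exists>x\<in>T i. c x \<notin> set cs}) * real (card I)
    \<le> real (length cs) * (4 * M / R) * N * real (card Q) ^ card X"
  using assms
proof (induction cs arbitrary: X Q I T)
  case Nil
  \<comment> \<open>With no colours left the size bound is \<open>2 ^ 0 = 1\<close>, so members are
    empty and no colouring can fail on a nonempty family.\<close>
  have "T i = {}" if "i \<in> I" for i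
    using Nil.prems(7)[OF that] Nil.prems(6)[OF that] Nil.prems(1) finite_subset by fastforce
  then have *: "{c \<in> X \<rightarrow>\<^sub>E Q. \<forall>i\<in>I. \<exists>x\<in>T i. c x \<notin> set []} = {}" if "I \<noteq> {}"
    using that by fastforce
  show ?case
  proof (cases "I = {}")
    case False
    show ?thesis unfolding *[OF False] by simp
  qed simp
next
  case (Cons q cs)
  note X = Cons.prems(1) and Q = Cons.prems(2) and I = Cons.prems(5) and TX = Cons.prems(6)
    and card_T = Cons.prems(7) and spread = Cons.prems(8) and QM = Cons.prems(9)
    and M = Cons.prems(10) and R = Cons.prems(11)
  have q: "q \<in> Q" and q_cs: "q \<notin> set cs" using Cons.prems by auto
  define m where "m = real (card Q)"
  have cardQ: "card Q \<ge> 1" using q Q by (metis One_nat_def Suc_leI card_gt_0_iff empty_iff)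
  have m: "m \<ge> 1" using cardQ by (simp add: m_def)
  have cardQ': "real (card (Q - {q})) = m - 1"
    using q Q cardQ by (simp add: m_def card_Diff_singleton of_nat_diff)
  have Rpos: "R > 0" using M R by linarith
  have N: "N \<ge> 0"
    using spread[of "{}"] by (smt (verit) empty_subsetI of_nat_0_le_iff card.empty power_0 mult_cancel_left2)
  have finT: "finite (T i)" if "i \<in> I" for i using that TX X finite_subset by blast
  have "\<exists>\<chi>. \<forall>W. \<forall>i. i \<in> I \<longrightarrow> \<chi> W i \<subseteq> T i - W \<and> (\<exists>j\<in>I. T j \<subseteq> W \<union> \<chi> W i) \<and>
      (\<forall>j\<in>I. T j \<subseteq> W \<union> \<chi> W i \<longrightarrow> \<chi> W i \<subseteq> T j)"
  proof -
    have "\<exists>C. i \<in> I \<longrightarrow> C \<subseteq> T i - W \<and> (\<exists>j\<in>I. T j \<subseteq> W \<union> C) \<and>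
        (\<forall>j\<in>I. T j \<subseteq> W \<union> C \<longrightarrow> C \<subseteq> T j)" for W i
      using minimal_residue_exists[where I = I and T = T and W = W and i = i] finT by blast
    then show ?thesis by (intro choice allI)
  qed
  then obtain \<chi> where \<chi>: "\<And>W i. i \<in> I \<Longrightarrow> \<chi> W i \<subseteq> T i - W"
      "\<And>W i. i \<in> I \<Longrightarrow> \<exists>j\<in>I. T j \<subseteq> W \<union> \<chi> W i"
      "\<And>W i j. i \<in> I \<Longrightarrow> j \<in> I \<Longrightarrow> T j \<subseteq> W \<union> \<chi> W i \<Longrightarrow> \<chi> W i \<subseteq> T j"
    by metis
  \<comment> \<open>Half of the size bound for \<open>q # cs\<close>: residues smaller than
    \<open>s\<close> meet the size hypothesis of the induction for \<open>cs\<close>, the others are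
    bad.\<close>
  define s where "s = (2::nat) ^ length cs"
  define fail where
    "fail W = {c \<in> (X - W) \<rightarrow>\<^sub>E (Q - {q}). \<forall>i\<in>I. \<exists>x\<in>T i. (\<lambda>x\<in>X. if x \<in> W then q else c x) x \<notin> set (q # cs)}" for W
  define good where "good W = {i \<in> I. card (\<chi> W i) < s}" for W
  define bad where "bad W = {i \<in> I. s \<le> card (\<chi> W i)}" for W
  have bad: "(\<Sum>W\<in>Pow X. (m - 1) ^ card (X - W) * real (card (bad W))) \<le> 4 * m / R * N * m ^ card X"
    unfolding bad_def
    by (rule bad_residues_bound[OF X I TX _ _ spread \<chi>])
       (use card_T m QM R in \<open>auto simp: s_def m_def\<close>)
  have step: "real (card (fail W)) * real (card I) \<le>
      real (length cs) * (4 * M / R) * N * (m - 1) ^ card (X - W) + (m - 1) ^ card (X - W) * real (card (bad W))"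
    if W: "W \<subseteq> X" for W
  proof -
    define fail' where
      "fail' = {c \<in> (X - W) \<rightarrow>\<^sub>E (Q - {q}). \<forall>i\<in>good W. \<exists>x\<in>\<chi> W i. c x \<notin> set cs}"
    have fin: "finite ((X - W) \<rightarrow>\<^sub>E (Q - {q}))" using X Q by (simp add: finite_PiE)
    \<comment> \<open>A good residue coloured entirely by \<open>cs\<close> would place some
      \<open>T j \<subseteq> W \<union> \<chi> W i\<close> inside the classes of
      \<open>q # cs\<close>. So failure passes to the good residues, on \<open>X - W\<close> with
      the colours \<open>Q - {q}\<close>.\<close>
    have "fail W \<subseteq> fail'"
    proof
      fix c assume c: "c \<in> fail W"
      have "\<exists>x\<in>\<chi> W i. c x \<notin> set cs" if i: "i \<in> good W" for i
      proof (rule ccontr)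
        assume *: "\<not> (\<exists>x\<in>\<chi> W i. c x \<notin> set cs)"
        have iI: "i \<in> I" using i by (simp add: good_def)
        obtain j where j: "j \<in> I" "T j \<subseteq> W \<union> \<chi> W i" using \<chi>(2)[OF iI] by blast
        then obtain x where x: "x \<in> T j" "(\<lambda>x\<in>X. if x \<in> W then q else c x) x \<notin> set (q # cs)"
          using c by (auto simp: fail_def)
        then show False using * j TX[OF j(1)] by (auto split: if_splits)
      qed
      then show "c \<in> fail'" using c by (auto simp: fail_def fail'_def)
    qed
    then have le': "card (fail W) \<le> card fail'"
      using fin by (intro card_mono) (auto simp: fail'_def)
    have "card (fail W) \<le> card ((X - W) \<rightarrow>\<^sub>E (Q - {q}))"
      using fin by (intro card_mono) (auto simp: fail_def)
    also have "\<dots> = card (Q - {q}) ^ card (X - W)" using X by (simp add: card_PiE)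
    finally have "real (card (fail W)) \<le> real (card (Q - {q}) ^ card (X - W))" by (rule of_nat_mono)
    then have le: "real (card (fail W)) \<le> (m - 1) ^ card (X - W)" by (simp add: cardQ')
    have "card I = card (good W \<union> bad W)" by (rule arg_cong[of _ _ card]) (auto simp: good_def bad_def)
    also have "\<dots> = card (good W) + card (bad W)"
      using I by (intro card_Un_disjoint) (auto simp: good_def bad_def)
    finally have cI: "card I = card (good W) + card (bad W)" .
    have "real (card fail') * real (card (good W))
        \<le> real (length cs) * (4 * M / R) * N * real (card (Q - {q})) ^ card (X - W)"
      unfolding fail'_def
    proof (rule Cons.IH)
      show "\<chi> W i \<subseteq> X - W" if "i \<in> good W" for i
        using that \<chi>(1)[of i W] TX[of i] by (auto simp: good_def)
      fix A assume A: "A \<subseteq> X - W"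
      have "card {i \<in> good W. A \<subseteq> \<chi> W i} \<le> card {i \<in> I. A \<subseteq> T i}"
        using I \<chi>(1)[of _ W] by (intro card_mono) (auto simp: good_def)
      then have "real (card {i \<in> good W. A \<subseteq> \<chi> W i}) * R ^ card A \<le> real (card {i \<in> I. A \<subseteq> T i}) * R ^ card A"
        using Rpos by (intro mult_right_mono) auto
      also have "\<dots> \<le> N" using A by (intro spread) auto
      finally show "real (card {i \<in> good W. A \<subseteq> \<chi> W i}) * R ^ card A \<le> N" .
    qed (use X Q Cons.prems I q_cs QM M R cardQ' in \<open>auto simp: good_def s_def m_def\<close>)
    then have "real (card (fail W)) * real (card (good W))
        \<le> real (length cs) * (4 * M / R) * N * (m - 1) ^ card (X - W)"
      using le' unfolding cardQ' by (smt (verit) mult_right_mono of_nat_0_le_iff of_nat_mono)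
    moreover have "real (card (fail W)) * real (card (bad W)) \<le> (m - 1) ^ card (X - W) * real (card (bad W))"
      using le by (intro mult_right_mono) auto
    ultimately show ?thesis unfolding cI by (simp add: algebra_simps)
  qed
  have "real (card {c \<in> X \<rightarrow>\<^sub>E Q. \<forall>i\<in>I. \<exists>x\<in>T i. c x \<notin> set (q # cs)}) * real (card I)
      = (\<Sum>W\<in>Pow X. real (card (fail W)) * real (card I))"
    unfolding fail_def by (subst card_colourings_split[OF X Q q]) (simp add: sum_distrib_right)
  also have "\<dots> \<le> (\<Sum>W\<in>Pow X. real (length cs) * (4 * M / R) * N * (m - 1) ^ card (X - W)
      + (m - 1) ^ card (X - W) * real (card (bad W)))"
    by (intro sum_mono step) auto
  also have "\<dots> = real (length cs) * (4 * M / R) * N * m ^ card X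
      + (\<Sum>W\<in>Pow X. (m - 1) ^ card (X - W) * real (card (bad W)))"
    using sum_Pow_power_card[OF X, of "m - 1"] unfolding sum.distrib sum_distrib_left[symmetric] by simp
  also have "\<dots> \<le> real (length cs) * (4 * M / R) * N * m ^ card X + 4 * M / R * N * m ^ card X"
  proof -
    \<comment> \<open>The number of colours drops during the induction while \<open>M\<close>,
      \<open>R\<close> and \<open>N\<close> stay fixed. Every colour therefore costs the same, which
      gives the factor \<open>length cs\<close>.\<close>
    have "4 * m / R * N * m ^ card X \<le> 4 * M / R * N * m ^ card X"
      using N Rpos QM m by (intro mult_right_mono divide_right_mono) (auto simp: m_def)
    then show ?thesis using bad by linarith
  qed
  also have "\<dots> = real (length (q # cs)) * (4 * M / R) * N * m ^ card X"
    by (simp add: algebra_simps add_divide_distrib)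
  finally show ?case by (simp add: m_def)
qed

text \<open>
  Splitting the colours into \<open>2 * r\<close> groups of \<open>l\<close>, a random colouring has a member inside the classes of a
  given group with probability at least \<open>3/4\<close>; members found by different groups are disjoint off the kernel.
\<close>

lemma sunflower:
  fixes \<F> :: "'a set set"
  assumes fin\<F>: "finite \<F>" and fin: "\<And>S. S \<in> \<F> \<Longrightarrow> finite S" and card_w: "\<And>S. S \<in> \<F> \<Longrightarrow> card S = w"
    and w: "w < 2 ^ l" and r: "r \<ge> 1" and l: "l \<ge> 1" and big: "card \<F> > (32 * r * l\<^sup>2) ^ w"
  shows "\<exists>K G. (\<forall>g<r. G g \<in> \<F> \<and> K \<subset> G g) \<and> (\<forall>g<r. \<forall>h<r. g \<noteq> h \<longrightarrow> (G g - K) \<inter> (G h - K) = {})"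
proof -
  define R where "R = real (32 * r * l\<^sup>2)"
  have "0 < 32 * r * l\<^sup>2" using r l by simp
  then have "1 \<le> 32 * r * l\<^sup>2" by linarith
  then have R: "R \<ge> 1" unfolding R_def by (metis of_nat_1 of_nat_mono)
  define X where "X = \<Union>\<F>"
  have finX: "finite X" using fin\<F> fin by (auto simp: X_def)
  \<comment> \<open>The kernel is a largest \<open>K\<close> satisfying \<open>P\<close>. By
    maximality, enlarging \<open>K\<close> by a nonempty disjoint \<open>A\<close> divides the
    number of members above it by more than \<open>R ^ card A\<close>; this is the spreadness of the
    link.\<close>
  define P where "P K \<longleftrightarrow> K \<subseteq> X \<and> real (card \<F>) \<le> real (card {S \<in> \<F>. K \<subseteq> S}) * R ^ card K" for K
  have "P {}" by (simp add: P_def)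
  moreover have "\<forall>K. P K \<longrightarrow> card K < Suc (card X)"
    using finX by (auto simp: P_def less_Suc_eq_le intro: card_mono)
  ultimately have "\<exists>K. P K \<and> (\<forall>K'. P K' \<longrightarrow> card K' \<le> card K)"
    by (rule Lattices_Big.ex_has_greatest_nat)
  then obtain K where K: "P K" and max: "\<And>K'. P K' \<Longrightarrow> card K' \<le> card K"
    by (elim exE conjE) simp
  define I where "I = {S \<in> \<F>. K \<subseteq> S}"
  have KX: "K \<subseteq> X" and finK: "finite K" using K finX finite_subset unfolding P_def by blast+
  have finI: "finite I" using fin\<F> by (simp add: I_def)
  have F0: "real (card \<F>) > R ^ w"
    using big unfolding R_def of_nat_power[symmetric] by (simp only: of_nat_less_iff)
  have I_pos: "card I > 0"
  proof (rule ccontr)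
    assume "\<not> card I > 0"
    then have "real (card \<F>) \<le> 0" using K by (simp add: P_def I_def)
    moreover have "0 \<le> R ^ w" using R by simp
    ultimately show False using F0 by linarith
  qed
  \<comment> \<open>A member equal to \<open>K\<close> would be the only one above \<open>K\<close>,
    so that \<open>P K\<close> would give at most \<open>R ^ w\<close> members in all.\<close>
  have proper: "K \<subset> S" if "S \<in> I" for S
  proof (rule ccontr)
    assume "\<not> K \<subset> S"
    then have "K = S" using that by (auto simp: I_def)
    then have cK: "card K = w" using that card_w by (auto simp: I_def)
    have "I \<subseteq> {K}"
    proof
      fix S' assume "S' \<in> I"
      then have "K \<subseteq> S'" "card S' = card K" "finite S'" using card_w fin cK by (auto simp: I_def)
      then have "K = S'" by (metis card_subset_eq)
      then show "S' \<in> {K}" by simp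
    qed
    then have "card I \<le> 1" using card_mono[of "{K}" I] by simp
    then have "real (card I) * R ^ card K \<le> 1 * R ^ w" using R cK by (intro mult_mono) auto
    then show False using K F0 by (simp add: P_def I_def)
  qed
  define T where "T S = S - K" for S :: "'a set"
  define Q where "Q = {..<2 * r * l}"
  have cardQ: "card Q = 2 * r * l" by (simp add: Q_def)
  define cs where "cs g = [g * l..<(g + 1) * l]" for g
  define fail where "fail g = {c \<in> X \<rightarrow>\<^sub>E Q. \<forall>S\<in>I. \<exists>x\<in>T S. c x \<notin> set (cs g)}" for g
  have finC: "finite (X \<rightarrow>\<^sub>E Q)" using finX by (simp add: finite_PiE Q_def)
  have cardC: "card (X \<rightarrow>\<^sub>E Q) = card Q ^ card X" using finX by (simp add: card_PiE)
  have spread: "real (card {S \<in> I. A \<subseteq> T S}) * R ^ card A \<le> real (card I)" if A: "A \<subseteq> X" for A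
  proof (cases "A \<inter> K = {}")
    case False
    then have *: "{S \<in> I. A \<subseteq> T S} = {}" by (auto simp: T_def)
    show ?thesis unfolding * by simp
  next
    case True
    have eq: "{S \<in> I. A \<subseteq> T S} = {S \<in> \<F>. K \<union> A \<subseteq> S}" using True by (auto simp: I_def T_def)
    have cKA: "card (K \<union> A) = card K + card A"
      using True finK finX A by (intro card_Un_disjoint) (auto intro: finite_subset)
    show ?thesis
    proof (rule ccontr)
      assume "\<not> ?thesis"
      then have less: "real (card I) < real (card {S \<in> \<F>. K \<union> A \<subseteq> S}) * R ^ card A" by (simp add: eq)
      have "real (card \<F>) \<le> real (card I) * R ^ card K" using K by (simp add: P_def I_def)
      also have "\<dots> \<le> (real (card {S \<in> \<F>. K \<union> A \<subseteq> S}) * R ^ card A) * R ^ card K"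
        using less R by (intro mult_right_mono) auto
      finally have "P (K \<union> A)" using A KX by (simp add: P_def cKA power_add mult_ac)
      then have "card A = 0" using max cKA by fastforce
      then have "A = {}" using A finX by (metis card_0_eq finite_subset)
      then show False using less by (simp add: I_def)
    qed
  qed
  have fail_le: "4 * real (card (fail g)) \<le> real (card (X \<rightarrow>\<^sub>E Q))" if g: "g < 2 * r" for g
  proof -
    have "(g + 1) * l \<le> (2 * r) * l" using g by (intro mult_le_mono1) auto
    then have sub: "set (cs g) \<subseteq> Q" by (auto simp: cs_def Q_def)
    have len: "length (cs g) = l" by (simp add: cs_def)
    define M where "M = real (2 * r * l)"
    \<comment> \<open>Origin of the constant 32: with \<open>R = 16 * l * M\<close>, a group of
      \<open>l\<close> colours fails for a fraction of at most
      \<open>l * (4 * M / R) = 1 / 4\<close> of the colourings.\<close>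
    have RM: "R = 16 * l * M" by (simp add: R_def M_def power2_eq_square)
    have "0 < 2 * r * l" using r l by simp
    then have "1 \<le> 2 * r * l" by linarith
    then have M1: "M \<ge> 1" unfolding M_def by (metis of_nat_1 of_nat_mono)
    have "real (card (fail g)) * real (card I) \<le> real (length (cs g)) * (4 * M / R) * real (card I) * real (card Q) ^ card X"
      unfolding fail_def
    proof (rule spread_family_colour_failures)
      fix S assume S: "S \<in> I"
      show "T S \<subseteq> X" using S by (auto simp: I_def T_def X_def)
      have "card (T S) \<le> card S" using S fin by (auto simp: I_def T_def intro: card_mono)
      then show "card (T S) < 2 ^ length (cs g)" using S card_w w len by (auto simp: I_def)
    next
      have "1 * M \<le> l * M" using l M1 by (intro mult_right_mono) auto
      then show "4 * M \<le> R" using M1 by (simp add: RM)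
    qed (use finX sub finI spread M1 in \<open>auto simp: Q_def cs_def M_def\<close>)
    also have "\<dots> = real (card Q) ^ card X / 4 * real (card I)"
      using l M1 by (simp add: len RM)
    finally have "real (card (fail g)) \<le> real (card Q) ^ card X / 4"
      using I_pos by simp
    then show ?thesis by (simp add: cardC)
  qed
  have C_pos: "card (X \<rightarrow>\<^sub>E Q) > 0" using r l by (simp add: cardC cardQ)
  \<comment> \<open>On average at most \<open>r / 2\<close> of the \<open>2 * r\<close> groups fail,
    so for some colouring at least \<open>r\<close> groups succeed simultaneously.\<close>
  have "\<exists>c\<in>X \<rightarrow>\<^sub>E Q. card {g \<in> {..<2 * r}. c \<in> fail g} \<le> r"
  proof (rule ccontr)
    assume "\<not> ?thesis"
    then have *: "real r \<le> real (card {g \<in> {..<2 * r}. c \<in> fail g})" if "c \<in> X \<rightarrow>\<^sub>E Q" for c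
      using that by (meson linorder_le_cases of_nat_mono)
    have "real r * real (card (X \<rightarrow>\<^sub>E Q)) = (\<Sum>c\<in>X \<rightarrow>\<^sub>E Q. real r)" by simp
    also have "\<dots> \<le> (\<Sum>c\<in>X \<rightarrow>\<^sub>E Q. real (card {g \<in> {..<2 * r}. c \<in> fail g}))"
      by (intro sum_mono *)
    also have "\<dots> = (\<Sum>c\<in>X \<rightarrow>\<^sub>E Q. \<Sum>g<2 * r. if c \<in> fail g then 1 else 0)"
      unfolding sum.inter_filter[OF finite_lessThan, symmetric] by simp
    also have "\<dots> = (\<Sum>g<2 * r. \<Sum>c\<in>X \<rightarrow>\<^sub>E Q. if c \<in> fail g then 1 else 0)"
      by (rule sum.swap)
    also have "\<dots> = (\<Sum>g<2 * r. real (card (fail g)))"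
    proof (rule sum.cong)
      fix g
      have *: "{c \<in> X \<rightarrow>\<^sub>E Q. c \<in> fail g} = fail g" by (auto simp: fail_def)
      show "(\<Sum>c\<in>X \<rightarrow>\<^sub>E Q. if c \<in> fail g then 1 else 0) = real (card (fail g))"
        unfolding sum.inter_filter[OF finC, symmetric] * by simp
    qed simp
    also have "\<dots> \<le> (\<Sum>g<2 * r. real (card (X \<rightarrow>\<^sub>E Q)) / 4)"
      using fail_le by (intro sum_mono) fastforce
    also have "\<dots> = real r * real (card (X \<rightarrow>\<^sub>E Q)) / 2" by simp
    finally have "real r * real (card (X \<rightarrow>\<^sub>E Q)) \<le> 0" by simp
    then show False using r C_pos by (simp add: mult_le_0_iff)
  qed
  then obtain c where c: "c \<in> X \<rightarrow>\<^sub>E Q" and few: "card {g \<in> {..<2 * r}. c \<in> fail g} \<le> r" by blast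
  define H where "H = {g \<in> {..<2 * r}. c \<notin> fail g}"
  have "card {..<2 * r} = card (H \<union> {g \<in> {..<2 * r}. c \<in> fail g})"
    by (rule arg_cong[of _ _ card]) (auto simp: H_def)
  also have "\<dots> \<le> card H + card {g \<in> {..<2 * r}. c \<in> fail g}" by (rule card_Un_le)
  finally have "r \<le> card H" using few by simp
  then have "card {..<r} \<le> card H" by simp
  moreover have "finite H" by (simp add: H_def)
  ultimately obtain \<iota> where \<iota>: "\<iota> ` {..<r} \<subseteq> H" "inj_on \<iota> {..<r}"
    using card_le_inj[of "{..<r}" H] by auto
  have "\<exists>S\<in>I. \<forall>x\<in>T S. c x \<in> set (cs g)" if "g \<in> H" for g
    using that c by (auto simp: H_def fail_def)
  then obtain G where G: "\<And>g. g \<in> H \<Longrightarrow> G g \<in> I" "\<And>g x. g \<in> H \<Longrightarrow> x \<in> T (G g) \<Longrightarrow> c x \<in> set (cs g)"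
    by metis
  have cs_disj: "g = h" if "y \<in> set (cs g)" "y \<in> set (cs h)" for g h y
  proof -
    have "y div l = g" "y div l = h"
      using that l by (auto simp: cs_def mult.commute intro!: div_nat_eqI)
    then show ?thesis by simp
  qed
  show ?thesis
  proof (intro exI[of _ K] exI[of _ "G \<circ> \<iota>"] conjI allI impI)
    fix g assume g: "g < r"
    then have \<iota>g: "\<iota> g \<in> H" using \<iota> by auto
    show "(G \<circ> \<iota>) g \<in> \<F>" "K \<subset> (G \<circ> \<iota>) g"
      using G(1)[OF \<iota>g] proper by (auto simp: I_def)
    fix h assume h: "h < r" and gh: "g \<noteq> h"
    then have \<iota>h: "\<iota> h \<in> H" using \<iota> by auto
    have "\<iota> g \<noteq> \<iota> h" using \<iota>(2) g h gh by (auto simp: inj_on_def)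
    then show "((G \<circ> \<iota>) g - K) \<inter> ((G \<circ> \<iota>) h - K) = {}"
      using G(2)[OF \<iota>g] G(2)[OF \<iota>h] cs_disj by (fastforce simp: T_def)
  qed
qed

section \<open>The upper bound\<close>

lemma power_self_le_fact: "n ^ n \<le> 3 ^ n * (fact n :: nat)"
proof (induction n)
  case (Suc n)
  have *: "(Suc n) ^ n \<le> 3 * n ^ n"
  proof (cases "n = 0")
    case False
    have "(1 + 1 / real n) ^ n \<le> exp (1 / real n) ^ n"
      by (intro power_mono exp_ge_add_one_self) auto
    also have "\<dots> = exp 1"
      using False by (simp flip: exp_of_nat_mult)
    also have "\<dots> \<le> 3" using exp_le by simp
    finally have "real n ^ n * (1 + 1 / real n) ^ n \<le> real n ^ n * 3"
      by (intro mult_left_mono) auto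
    also have "real n ^ n * (1 + 1 / real n) ^ n = real (Suc n) ^ n"
      using False by (simp add: power_mult_distrib[symmetric] field_simps)
    finally have "real (Suc n ^ n) \<le> real (3 * n ^ n)" by (simp add: mult.commute)
    then show ?thesis by (simp only: of_nat_le_iff)
  qed simp
  have "(Suc n) ^ Suc n = Suc n * (Suc n) ^ n" by simp
  also have "\<dots> \<le> Suc n * (3 * n ^ n)" using * by (intro mult_le_mono2)
  also have "\<dots> \<le> Suc n * (3 * (3 ^ n * fact n))" using Suc by (intro mult_le_mono2)
  finally show ?case by (simp add: algebra_simps)
qed simp

text \<open>Greedy extension: the at most \<open>j * k\<close> vertices of a matching of size
  \<open>j\<close> meet at most \<open>j * k * D\<close> edges, so at least half of all edges extend
  it. Forgetting the order of the choices costs \<open>fact j\<close>.\<close>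

lemma card_matchings_lower_bound:
  fixes E :: "'a set set"
  assumes E: "finite E" and f: "\<And>f. f \<in> E \<Longrightarrow> finite f \<and> f \<noteq> {} \<and> card f \<le> k"
    and deg: "\<And>v. vertex_degree E v \<le> D" and "2 * j * k * D \<le> card E"
  shows "card E ^ j \<le> 2 ^ j * card {M. M \<subseteq> E \<and> card M = j \<and> disjoint M} * fact j"
  using assms(4)
proof (induction j)
  case 0
  have "{M. M \<subseteq> E \<and> card M = 0 \<and> disjoint M} = {{}}"
    using E by (auto dest: finite_subset)
  then show ?case by simp
next
  case (Suc j)
  define \<M> where "\<M> i = {M. M \<subseteq> E \<and> card M = i \<and> disjoint M}" for i
  have fin\<M>: "finite (\<M> i)" for i
    unfolding \<M>_def by (rule finite_subset[of _ "Pow E"]) (use E in auto)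
  have "2 * j * k * D \<le> 2 * Suc j * k * D" by (intro mult_le_mono1) auto
  then have IH: "card E ^ j \<le> 2 ^ j * card (\<M> j) * fact j"
    using Suc unfolding \<M>_def by linarith
  define B where "B M = {f \<in> E. f \<inter> \<Union>M = {}}" for M
  have cardB: "card E \<le> 2 * card (B M)" if M: "M \<in> \<M> j" for M
  proof -
    have ME: "M \<subseteq> E" and cM: "card M = j" using M by (auto simp: \<M>_def)
    have finM: "finite M" using ME E finite_subset by blast
    have finU: "finite (\<Union>M)" using finM ME f by auto
    have "card (\<Union>M) \<le> (\<Sum>g\<in>M. card g)" by (rule card_Union_le_sum_card)
    also have "\<dots> \<le> j * k" using sum_bounded_above[of M card k] ME f cM by fastforce
    finally have cU: "card (\<Union>M) \<le> j * k" .
    have "card E = card (B M \<union> (\<Union>v\<in>\<Union>M. {f \<in> E. v \<in> f}))"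
      by (rule arg_cong[of _ _ card]) (auto simp: B_def)
    also have "\<dots> \<le> card (B M) + card (\<Union>v\<in>\<Union>M. {f \<in> E. v \<in> f})" by (rule card_Un_le)
    also have "card (\<Union>v\<in>\<Union>M. {f \<in> E. v \<in> f}) \<le> (\<Sum>v\<in>\<Union>M. card {f \<in> E. v \<in> f})"
      by (rule card_UN_le[OF finU])
    also have "\<dots> \<le> card (\<Union>M) * D"
      using sum_bounded_above[of "\<Union>M" "\<lambda>v. card {f \<in> E. v \<in> f}" D] deg by (auto simp: vertex_degree_def)
    also have "\<dots> \<le> (j * k) * D" using cU by (rule mult_le_mono1)
    finally have "card E \<le> card (B M) + j * k * D" by simp
    moreover have "2 * (j * k * D) \<le> card E" using Suc.prems by (simp add: algebra_simps)
    ultimately show ?thesis by linarith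
  qed
  \<comment> \<open>Keeping the added edge as a second component makes the map injective; a matching
    of size \<open>Suc j\<close> offers \<open>Suc j\<close> possibilities for it.\<close>
  define \<phi> where "\<phi> = (\<lambda>(M, f :: 'a set). (insert f M, f))"
  have fM: "f \<notin> M" if "M \<in> \<M> j" "f \<in> B M" for M f
    using that f by (fastforce simp: B_def \<M>_def)
  have "card (Sigma (\<M> j) B) \<le> card (Sigma (\<M> (Suc j)) (\<lambda>M. M))"
  proof (rule card_inj_on_le[where f = \<phi>])
    show "inj_on \<phi> (Sigma (\<M> j) B)"
    proof (rule inj_onI, clarify)
      fix M f M' f' assume *: "M \<in> \<M> j" "f \<in> B M" "M' \<in> \<M> j" "f' \<in> B M'" "\<phi> (M, f) = \<phi> (M', f')"
      then have "f = f'" "insert f M = insert f M'" by (auto simp: \<phi>_def)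
      moreover have "f \<notin> M" "f' \<notin> M'" using fM * by blast+
      ultimately show "M = M' \<and> f = f'" by (simp add: insert_ident)
    qed
    show "\<phi> ` Sigma (\<M> j) B \<subseteq> Sigma (\<M> (Suc j)) (\<lambda>M. M)"
    proof (rule image_subsetI, clarify)
      fix M f assume *: "M \<in> \<M> j" "f \<in> B M"
      then have "finite M" "f \<notin> M" using fM E finite_subset by (auto simp: \<M>_def)
      then show "\<phi> (M, f) \<in> Sigma (\<M> (Suc j)) (\<lambda>M. M)"
        using * by (auto simp: \<phi>_def \<M>_def B_def disjoint_def pairwise_def disjnt_iff)
    qed
    show "finite (Sigma (\<M> (Suc j)) (\<lambda>M. M))"
      using fin\<M> E by (intro finite_SigmaI) (auto simp: \<M>_def intro: finite_subset)
  qed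
  also have "card (Sigma (\<M> (Suc j)) (\<lambda>M. M)) = (\<Sum>M\<in>\<M> (Suc j). card M)"
    using fin\<M> E by (intro card_SigmaI) (auto simp: \<M>_def intro: finite_subset)
  also have "\<dots> = (\<Sum>M\<in>\<M> (Suc j). Suc j)" by (intro sum.cong) (auto simp: \<M>_def)
  finally have 1: "card (Sigma (\<M> j) B) \<le> card (\<M> (Suc j)) * Suc j" by simp
  have "card (\<M> j) * card E = (\<Sum>M\<in>\<M> j. card E)" by simp
  also have "\<dots> \<le> (\<Sum>M\<in>\<M> j. 2 * card (B M))" by (intro sum_mono cardB)
  also have "\<dots> = 2 * card (Sigma (\<M> j) B)"
    unfolding sum_distrib_left[symmetric] using fin\<M> E by (subst card_SigmaI) (auto simp: B_def)
  also have "\<dots> \<le> 2 * (card (\<M> (Suc j)) * Suc j)" using 1 by simp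
  finally have 2: "card (\<M> j) * card E \<le> 2 * (card (\<M> (Suc j)) * Suc j)" .
  have "card E ^ Suc j \<le> (2 ^ j * card (\<M> j) * fact j) * card E"
    using IH by (simp add: mult.commute mult_le_mono)
  also have "\<dots> = 2 ^ j * fact j * (card (\<M> j) * card E)" by (simp add: mult_ac)
  also have "\<dots> \<le> 2 ^ j * fact j * (2 * (card (\<M> (Suc j)) * Suc j))" using 2 by (rule mult_le_mono2)
  also have "\<dots> = 2 ^ Suc j * card (\<M> (Suc j)) * fact (Suc j)" by (simp add: algebra_simps)
  finally show ?case by (simp only: \<M>_def)
qed

text \<open>The matchings have size \<open>m\<close> and are themselves the members of the
  sunflower. A vertex of a petal is missed by the kernel, because both lie in one matching. Since
  every \<open>G g\<close> covers \<open>U\<close>, each petal covers that vertex exactly once, and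
  the petals are disjoint.\<close>

lemma regular_subhypergraph_of_many_matchings:
  fixes \<M> :: "'a set set set"
  assumes fin: "finite \<M>" and finM: "\<And>M. M \<in> \<M> \<Longrightarrow> finite M"
    and M: "\<And>M. M \<in> \<M> \<Longrightarrow> M \<subseteq> E \<and> card M = m \<and> disjoint M \<and> \<Union>M = U"
    and ne: "{} \<notin> E" and m: "m < 2 ^ l" and r: "r \<ge> 1" and l: "l \<ge> 1"
    and big: "card \<M> > (32 * r * l\<^sup>2) ^ m"
  shows "has_regular_subhypergraph r E"
proof -
  obtain K G where G: "\<And>g. g < r \<Longrightarrow> G g \<in> \<M>" "\<And>g. g < r \<Longrightarrow> K \<subset> G g"
    and disj: "\<And>g h. g < r \<Longrightarrow> h < r \<Longrightarrow> g \<noteq> h \<Longrightarrow> (G g - K) \<inter> (G h - K) = {}"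
    using sunflower[of \<M> m l r] fin finM M m r l big by metis
  define F where "F = (\<Union>g<r. G g - K)"
  have "F \<noteq> {}" using G(2)[of 0] r unfolding F_def by fastforce
  moreover have "vertex_degree F v = r" if v: "v \<in> \<Union>F" for v
  proof -
    obtain g0 f where g0: "g0 < r" "f \<in> G g0" "f \<notin> K" "v \<in> f" using v by (auto simp: F_def)
    have vK: "v \<notin> f'" if "f' \<in> K" for f'
    proof
      assume "v \<in> f'"
      moreover have "f' \<in> G g0" "f' \<noteq> f" using that G(2)[OF g0(1)] g0 by auto
      moreover have "disjoint (G g0)" using M[OF G(1)[OF g0(1)]] by simp
      ultimately show False using g0 disjointD[of "G g0" f' f] by blast
    qed
    have "v \<in> U" using M[OF G(1)[OF g0(1)]] g0 by auto
    then have "\<exists>f\<in>G g - K. v \<in> f" if "g < r" for g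
      using M[OF G(1)[OF that]] vK by auto
    then obtain \<psi> where \<psi>: "\<And>g. g < r \<Longrightarrow> \<psi> g \<in> G g - K" "\<And>g. g < r \<Longrightarrow> v \<in> \<psi> g" by metis
    have "{f \<in> F. v \<in> f} = \<psi> ` {..<r}"
    proof (intro equalityI subsetI)
      fix f assume "f \<in> {f \<in> F. v \<in> f}"
      then obtain g where g: "g < r" "f \<in> G g - K" "v \<in> f" by (auto simp: F_def)
      moreover have "disjoint (G g)" using M[OF G(1)[OF g(1)]] by simp
      ultimately have "f = \<psi> g" using \<psi>[OF g(1)] disjointD[of "G g" f "\<psi> g"] by blast
      then show "f \<in> \<psi> ` {..<r}" using g by auto
    next
      fix f assume "f \<in> \<psi> ` {..<r}"
      then obtain g where "g < r" "f = \<psi> g" by auto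
      then show "f \<in> {f \<in> F. v \<in> f}" using \<psi>[of g] unfolding F_def by blast
    qed
    moreover have "inj_on \<psi> {..<r}"
    proof (rule inj_onI, rule ccontr)
      fix g h assume *: "g \<in> {..<r}" "h \<in> {..<r}" "\<psi> g = \<psi> h" "g \<noteq> h"
      then show False using \<psi>(1)[of g] \<psi>(1)[of h] disj[of g h] by auto
    qed
    ultimately show ?thesis by (simp add: vertex_degree_def card_image)
  qed
  ultimately have "regular_hypergraph r F" by (simp add: regular_hypergraph_def)
  moreover have "F \<subseteq> E" using G(1) M unfolding F_def by blast
  ultimately show ?thesis by (auto simp: has_regular_subhypergraph_def)
qed

section \<open>Degrees, dyadic levels and the number of edges\<close>

text \<open>Edges through \<open>v\<close> share no other vertex, so choosing a second vertex in
  each is injective.\<close>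

lemma vertex_degree_le_if_linear:
  fixes E :: "nat set set"
  assumes k: "k \<ge> 2" and E: "uniform_hypergraph k {..<n} E" and lin: "linear_hypergraph E"
  shows "vertex_degree E v \<le> n"
proof -
  have fin: "finite f" "f \<subseteq> {..<n}" "card f = k" if "f \<in> E" for f
    using that E by (auto simp: uniform_hypergraph_def intro: finite_subset)
  have "\<exists>x. x \<in> f - {v}" if "f \<in> E" for f
  proof (rule ccontr)
    assume "\<nexists>x. x \<in> f - {v}"
    then have "f \<subseteq> {v}" by blast
    then have "card f \<le> 1" using card_mono[of "{v}" f] by simp
    then show False using fin(3)[OF that] k by simp
  qed
  then obtain x where x: "\<And>f. f \<in> E \<Longrightarrow> x f \<in> f - {v}" by metis
  have "inj_on x {f \<in> E. v \<in> f}"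
  proof (rule inj_onI, rule ccontr, clarify)
    fix f g assume *: "f \<in> E" "g \<in> E" "v \<in> f" "v \<in> g" "x f = x g" "f \<noteq> g"
    have "{v, x f} \<subseteq> f \<inter> g" using * x[of f] x[of g] by auto
    then have "card {v, x f} \<le> card (f \<inter> g)" using fin(1)[OF *(1)] by (intro card_mono) auto
    also have "\<dots> \<le> 1" using * lin by (auto simp: linear_hypergraph_def)
    finally show False using x[OF *(1)] by auto
  qed
  moreover have "x ` {f \<in> E. v \<in> f} \<subseteq> {..<n}" using x fin(2) by blast
  ultimately have "card {f \<in> E. v \<in> f} \<le> card {..<n}" by (intro card_inj_on_le) auto
  then show ?thesis by (simp add: vertex_degree_def)
qed

lemma sum_vertex_degree:
  fixes E :: "nat set set"
  assumes "uniform_hypergraph k {..<n} E"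
  shows "(\<Sum>v<n. vertex_degree E v) = k * card E"
proof -
  have "finite E"
    by (rule finite_subset[of _ "Pow {..<n}"]) (use assms in \<open>auto simp: uniform_hypergraph_def\<close>)
  moreover have "{v \<in> {..<n}. v \<in> f} = f" if "f \<in> E" for f
    using that assms by (auto simp: uniform_hypergraph_def)
  ultimately show ?thesis
    unfolding vertex_degree_def using assms
    by (intro sum_multicount) (auto simp: uniform_hypergraph_def)
qed

lemma popular_level:
  fixes t :: "'a \<Rightarrow> nat"
  assumes "finite E" "\<And>f. f \<in> E \<Longrightarrow> t f < l"  "l \<ge> 1"
  shows "\<exists>\<tau><l. card E \<le> l * card {f \<in> E. t f = \<tau>}"
proof (rule ccontr)
  assume "\<not> ?thesis"
  then have *: "l * card {f \<in> E. t f = \<tau>} < card E" if "\<tau> < l" for \<tau>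
    using that by (meson not_le)
  have "l * card E = l * (\<Sum>\<tau><l. \<Sum>f\<in>{f \<in> E. t f = \<tau>}. 1)"
    using assms by (subst sum.group) auto
  also have "\<dots> = (\<Sum>\<tau><l. l * card {f \<in> E. t f = \<tau>})" by (simp add: sum_distrib_left)
  also have "\<dots> < (\<Sum>\<tau><l. card E)"
    using * assms by (intro sum_strict_mono) (auto simp: lessThan_empty_iff)
  finally show False by simp
qed

text \<open>
  A matching is recorded by the set of its distinguished vertices \<open>h f\<close> and the set of its other vertices.
\<close>

lemma card_matchings_upper_bound:
  fixes E :: "nat set set"
  assumes k: "k \<ge> 2" and E: "\<And>f. f \<in> E \<Longrightarrow> f \<subseteq> {..<n} \<and> card f = k"
    and h: "\<And>f. f \<in> E \<Longrightarrow> h f \<in> f \<and> h f \<in> V" and V: "finite V"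
    and r: "r \<ge> 1" and l: "l \<ge> 1" "n < 2 ^ l" and no: "\<not> has_regular_subhypergraph r E"
  shows "card {M. M \<subseteq> E \<and> card M = m \<and> disjoint M}
    \<le> (32 * r * l\<^sup>2) ^ m * ((card V choose m) * (n choose ((k - 1) * m)))"
proof -
  define \<M> where "\<M> = {M. M \<subseteq> E \<and> card M = m \<and> disjoint M}"
  define \<Phi> where "\<Phi> M = (h ` M, \<Union>M - h ` M)" for M
  define P where "P = {A. A \<subseteq> V \<and> card A = m} \<times> {B. B \<subseteq> {..<n} \<and> card B = (k - 1) * m}"
  have finE: "finite E" by (rule finite_subset[of _ "Pow {..<n}"]) (use E in auto)
  have finf: "finite f" if "f \<in> E" for f using E[OF that] finite_subset by blast
  have fin\<M>: "finite \<M>"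
    unfolding \<M>_def by (rule finite_subset[of _ "Pow E"]) (use finE in auto)
  have finP: "finite P" unfolding P_def using V by simp
  have cardP: "card P = (card V choose m) * (n choose ((k - 1) * m))"
    unfolding P_def using V by (simp add: card_cartesian_product n_subsets)
  have cU: "card (\<Union>M) = k * m" if M: "M \<in> \<M>" for M
  proof -
    have "card (\<Union>M) = (\<Sum>f\<in>M. card f)"
      using M finf by (intro card_Union_disjoint) (auto simp: \<M>_def disjoint_def pairwise_def disjnt_iff)
    also have "\<dots> = (\<Sum>f\<in>M. k)" using M E by (intro sum.cong) (auto simp: \<M>_def)
    finally show ?thesis using M by (simp add: \<M>_def mult.commute)
  qed
  have sub: "h ` M \<subseteq> \<Union>M" if "M \<in> \<M>" for M using that h by (auto simp: \<M>_def)
  have \<Phi>P: "\<Phi> M \<in> P" if M: "M \<in> \<M>" for M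
  proof -
    have "inj_on h M"
    proof (rule inj_onI, rule ccontr)
      fix f g assume *: "f \<in> M" "g \<in> M" "h f = h g" "f \<noteq> g"
      then have "f \<inter> g = {}" using M by (auto simp: \<M>_def disjoint_def pairwise_def disjnt_iff)
      then show False using * M h[of f] h[of g] by (auto simp: \<M>_def)
    qed
    then have ch: "card (h ` M) = m" using M by (simp add: card_image \<M>_def)
    have finM: "finite M" using M finE finite_subset by (auto simp: \<M>_def)
    have "card (\<Union>M - h ` M) = k * m - m"
      using finM sub[OF M] cU[OF M] ch by (subst card_Diff_subset) auto
    then have "card (\<Union>M - h ` M) = (k - 1) * m" by (simp add: diff_mult_distrib)
    moreover have "\<Union>M \<subseteq> {..<n}" using M E by (force simp: \<M>_def)
    ultimately show ?thesis using ch M h by (auto simp: \<Phi>_def P_def \<M>_def)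
  qed
  \<comment> \<open>All matchings in a fibre cover the same set \<open>fst p \<union> snd p\<close>,
    so a larger fibre would yield an \<open>r\<close>-regular subhypergraph.\<close>
  have fibre: "card {M \<in> \<M>. \<Phi> M = p} \<le> (32 * r * l\<^sup>2) ^ m" for p
  proof (rule ccontr)
    assume "\<not> ?thesis"
    then have big: "card {M \<in> \<M>. \<Phi> M = p} > (32 * r * l\<^sup>2) ^ m" by simp
    then have "{M \<in> \<M>. \<Phi> M = p} \<noteq> {}" by (metis card.empty not_less_zero)
    then obtain M where M: "M \<in> \<M>" by blast
    have "k * m = card (\<Union>M)" using cU[OF M] by simp
    also have "\<dots> \<le> card {..<n}" using M E by (intro card_mono) (force simp: \<M>_def)+
    finally have "k * m \<le> n" by simp
    moreover have "1 * m \<le> k * m" using k by (intro mult_le_mono1) auto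
    ultimately have m: "m < 2 ^ l" using l by linarith
    have "has_regular_subhypergraph r E"
    proof (rule regular_subhypergraph_of_many_matchings[OF _ _ _ _ m r l(1) big])
      fix M assume M: "M \<in> {M \<in> \<M>. \<Phi> M = p}"
      have "\<Union>M = h ` M \<union> (\<Union>M - h ` M)" using sub M by blast
      then have "\<Union>M = fst p \<union> snd p" using M by (auto simp: \<Phi>_def)
      then show "M \<subseteq> E \<and> card M = m \<and> disjoint M \<and> \<Union>M = fst p \<union> snd p" using M by (auto simp: \<M>_def)
      then show "finite M" using finE finite_subset by blast
    next
      show "{} \<notin> E" using E k by force
    qed (use fin\<M> in simp)
    then show False using no by simp
  qed
  have "card \<M> = (\<Sum>p\<in>P. \<Sum>M\<in>{M \<in> \<M>. \<Phi> M = p}. 1)"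
    using fin\<M> finP \<Phi>P by (subst sum.group) auto
  also have "\<dots> = (\<Sum>p\<in>P. card {M \<in> \<M>. \<Phi> M = p})" by simp
  also have "\<dots> \<le> card P * (32 * r * l\<^sup>2) ^ m"
    using sum_bounded_above[of P "\<lambda>p. card {M \<in> \<M>. \<Phi> M = p}" "(32 * r * l\<^sup>2) ^ m"] fibre by simp
  finally show ?thesis unfolding \<M>_def cardP by (simp add: mult.commute)
qed

text \<open>Both counts of matchings are compared on a single dyadic level. Stating the result for
  the power \<open>k - 1\<close> keeps the argument within the natural numbers; roots are taken only
  afterwards.\<close>

lemma card_edges_power_bound:
  fixes E :: "nat set set"
  assumes k: "k \<ge> 2" and E: "uniform_hypergraph k {..<n} E" and lin: "linear_hypergraph E"
    and no: "\<not> has_regular_subhypergraph r E"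
    and r: "r \<ge> 1" and n: "n \<ge> 1" and l: "n < 2 ^ l"
  shows "card E ^ (k - 1) \<le> 64 * k * (24 * k) ^ (k - 1) * r * l ^ (k + 2) * n ^ (2 * k - 3)"
proof -
  define c where "c = k - 1"
  have c: "c \<ge> 1" "k = c + 1" using k by (auto simp: c_def)
  have l1: "l \<ge> 1" using l n by (cases l) auto
  have finE: "finite E"
    by (rule finite_subset[of _ "Pow {..<n}"]) (use E in \<open>auto simp: uniform_hypergraph_def\<close>)
  have Ef: "f \<subseteq> {..<n}" "card f = k" "finite f" "f \<noteq> {}" if "f \<in> E" for f
    using that E k by (auto simp: uniform_hypergraph_def intro: finite_subset)
  define deg where "deg = vertex_degree E"
  have degn: "deg v \<le> n" for v unfolding deg_def by (rule vertex_degree_le_if_linear[OF k E lin])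
  \<comment> \<open>For each edge, \<open>x\<close> has maximal degree in it and \<open>t\<close> is
    the dyadic level of that degree. The upper estimate for all vertices of the edge serves the
    greedy choice, the lower one for \<open>x\<close> keeps the set \<open>V\<close> small.\<close>
  have "\<exists>x t. x \<in> f \<and> (\<forall>v\<in>f. deg v < 2 ^ (t + 1)) \<and> 2 ^ t \<le> deg x" if f: "f \<in> E" for f
  proof -
    have "Max (deg ` f) \<in> deg ` f" using Ef[OF f] by (intro Max_in) auto
    then obtain x where x: "x \<in> f" "deg x = Max (deg ` f)" by auto
    have "f \<in> {f \<in> E. x \<in> f}" using f x by simp
    then have "card {f} \<le> deg x"
      unfolding deg_def vertex_degree_def using finE by (intro card_mono) auto
    then have "deg x \<ge> 1" by simp
    then obtain t where t: "2 ^ t \<le> deg x" "deg x < 2 ^ (t + 1)" using ex_power_ivl1[of 2 "deg x"] by auto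
    have "deg v < 2 ^ (t + 1)" if "v \<in> f" for v
    proof -
      have "deg v \<le> Max (deg ` f)" using that Ef[OF f] by (intro Max_ge) auto
      then show ?thesis using t x by simp
    qed
    then show ?thesis using x t by blast
  qed
  then obtain h t where ht: "\<And>f. f \<in> E \<Longrightarrow> h f \<in> f" "\<And>f v. f \<in> E \<Longrightarrow> v \<in> f \<Longrightarrow> deg v < 2 ^ (t f + 1)"
      "\<And>f. f \<in> E \<Longrightarrow> 2 ^ t f \<le> deg (h f)" by metis
  have tl: "t f < l" if "f \<in> E" for f
  proof -
    have "(2::nat) ^ t f < 2 ^ l" using ht(3)[OF that] degn[of "h f"] l by linarith
    then show ?thesis by simp
  qed
  obtain \<tau> where \<tau>: "card E \<le> l * card {f \<in> E. t f = \<tau>}"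
    using popular_level[of E t l] finE tl l1 by blast
  define E' where "E' = {f \<in> E. t f = \<tau>}"
  define e where "e = card E'"
  define q where "q = (2::nat) ^ \<tau>"
  define V where "V = {v \<in> {..<n}. q \<le> deg v}"
  \<comment> \<open>The largest size allowed by the greedy count: degrees are below
    \<open>2 * q\<close>, so \<open>2 * m * k * (2 * q) \<le> e\<close> is required.\<close>
  define m where "m = e div (4 * k * q)"
  define K where "K = 32 * r * l\<^sup>2"
  have E'E: "E' \<subseteq> E" by (auto simp: E'_def)
  have finE': "finite E'" using finE E'E finite_subset by blast
  have El: "card E \<le> l * e" using \<tau> by (simp add: e_def E'_def)
  have q1: "q \<ge> 1" by (simp add: q_def)
  show ?thesis
  proof (cases "e = 0")
    case True
    then have "card E ^ (k - 1) = 0" using El k by simp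
    then show ?thesis by linarith
  next
    case False
    then have e: "e > 0" by simp
    then have "E' \<noteq> {}" by (auto simp: e_def)
    then obtain f where "f \<in> E'" by blast
    then have qn: "q \<le> n" using ht(3)[of f] degn[of "h f"] by (auto simp: E'_def q_def)
    have key: "e ^ c \<le> 2 * k * (24 * k) ^ c * K * l * n ^ (2 * c - 1)"
    proof (cases "m = 0")
      case True
      \<comment> \<open>The level is too sparse for the greedy count. Here \<open>e\<close> is
        already linear in \<open>n\<close>, and \<open>c \<le> 2 * c - 1\<close>.\<close>
      then have "e < 4 * k * q" using k q1 by (simp add: m_def div_eq_0_iff)
      then have "e \<le> 4 * k * n" using qn by (meson less_imp_le_nat le_trans mult_le_mono2)
      then have "e ^ c \<le> (4 * k * n) ^ c" by (rule power_mono) simp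
      also have "\<dots> = (4 * k) ^ c * n ^ c" by (simp add: power_mult_distrib)
      also have "\<dots> \<le> (24 * k) ^ c * n ^ (2 * c - 1)"
        using n c by (intro mult_le_mono power_mono power_increasing) auto
      also have "\<dots> \<le> (2 * k * K * l) * ((24 * k) ^ c * n ^ (2 * c - 1))"
      proof -
        have "0 < 2 * k * K * l" using k r l1 by (simp add: K_def)
        then have "1 \<le> 2 * k * K * l" by linarith
        from mult_le_mono1[OF this] show ?thesis by (metis mult_1)
      qed
      finally show ?thesis by (simp add: mult_ac)
    next
      case False
      then have m: "m \<ge> 1" by simp
      define a where "a = card {M. M \<subseteq> E' \<and> card M = m \<and> disjoint M}"
      have lower: "e ^ m \<le> 2 ^ m * a * fact m"
        unfolding e_def a_def
      proof (rule card_matchings_lower_bound[where k = k and D = "2 * q"])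
        fix v
        show "vertex_degree E' v \<le> 2 * q"
        proof (cases "\<exists>f\<in>E'. v \<in> f")
          case True
          then have "deg v < 2 * q" using ht(2) by (auto simp: E'_def q_def)
          moreover have "vertex_degree E' v \<le> deg v"
            unfolding deg_def vertex_degree_def using finE E'E by (intro card_mono) auto
          ultimately show ?thesis by simp
        next
          case False
          then have *: "{f \<in> E'. v \<in> f} = {}" by blast
          show ?thesis unfolding vertex_degree_def * by simp
        qed
      next
        have "m * (4 * k * q) \<le> e" unfolding m_def by (rule div_times_less_eq_dividend)
        then show "2 * m * k * (2 * q) \<le> card E'" by (simp add: e_def mult_ac)
      next
        show "finite f \<and> f \<noteq> {} \<and> card f \<le> k" if "f \<in> E'" for f
          using Ef[of f] that E'E by auto
      qed (rule finE')
      have "\<not> has_regular_subhypergraph r E'"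
        using no E'E by (meson has_regular_subhypergraph_def subset_trans)
      then have upper: "a \<le> K ^ m * ((card V choose m) * (n choose (c * m)))"
        unfolding a_def K_def c_def
      proof (intro card_matchings_upper_bound[where h = h])
        show "f \<subseteq> {..<n} \<and> card f = k" if "f \<in> E'" for f
          using Ef[of f] that E'E by auto
        show "h f \<in> f \<and> h f \<in> V" if "f \<in> E'" for f
        proof -
          have "f \<in> E" "t f = \<tau>" using that by (auto simp: E'_def)
          then show ?thesis using ht(1,3)[of f] Ef(1)[of f] by (auto simp: V_def q_def)
        qed
        show "finite V" by (simp add: V_def)
      qed (use l l1 r k in simp_all)
      \<comment> \<open>The factor \<open>m ^ (c * m)\<close> is supplied in advance to cancel, up
        to \<open>3 ^ (c * m)\<close>, the factorial of \<open>n choose (c * m)\<close>. The other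
        factorial is already present in \<open>lower\<close>, so that an \<open>m\<close>-th root
        can be taken.\<close>
      have "(e * m ^ c) ^ m = e ^ m * m ^ (c * m)" by (simp add: power_mult_distrib power_mult)
      also have "\<dots> \<le> (2 ^ m * a * fact m) * (c * m) ^ (c * m)"
        using lower c by (intro mult_le_mono power_mono) auto
      also have "\<dots> \<le> (2 ^ m * (K ^ m * ((card V choose m) * (n choose (c * m)))) * fact m) * (3 ^ (c * m) * fact (c * m))"
        using upper power_self_le_fact[of "c * m"] by (intro mult_le_mono) auto
      also have "\<dots> = 2 ^ m * K ^ m * 3 ^ (c * m) * (((card V choose m) * fact m) * ((n choose (c * m)) * fact (c * m)))"
        by (simp add: mult_ac)
      also have "\<dots> \<le> 2 ^ m * K ^ m * 3 ^ (c * m) * (card V ^ m * n ^ (c * m))"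
        using binomial_fact_pow by (intro mult_le_mono) auto
      also have "\<dots> = (2 * K * card V * (3 * n) ^ c) ^ m"
        by (simp add: power_mult_distrib power_mult mult_ac)
      finally have "e * m ^ c \<le> 2 * K * card V * (3 * n) ^ c"
        using m by (simp add: power_mono_iff)
      \<comment> \<open>Multiplying by \<open>q\<close> brings in \<open>card V * q\<close>, which
        the degree sum bounds by \<open>k * l * e\<close>; the factor \<open>e\<close> then
        cancels.\<close>
      then have "q * (e * m ^ c) \<le> q * (2 * K * card V * (3 * n) ^ c)" by (rule mult_le_mono2)
      also have "\<dots> = 2 * K * (3 * n) ^ c * (card V * q)" by (simp add: mult_ac)
      also have "\<dots> \<le> 2 * K * (3 * n) ^ c * (k * (l * e))"
      proof (intro mult_le_mono2)
        have "card V * q = (\<Sum>v\<in>V. q)" by simp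
        also have "\<dots> \<le> (\<Sum>v\<in>V. deg v)" by (intro sum_mono) (simp add: V_def)
        also have "\<dots> \<le> (\<Sum>v<n. deg v)" by (intro sum_mono2) (auto simp: V_def)
        also have "\<dots> = k * card E" unfolding deg_def by (rule sum_vertex_degree[OF E])
        also have "\<dots> \<le> k * (l * e)" using El by (rule mult_le_mono2)
        finally show "card V * q \<le> k * (l * e)" .
      qed
      finally have "e * (q * m ^ c) \<le> e * (2 * K * (3 * n) ^ c * (k * l))" by (simp add: mult_ac)
      then have qm: "q * m ^ c \<le> 2 * K * (3 * n) ^ c * (k * l)" using e by simp
      have "e < (m + 1) * (4 * k * q)"
        unfolding m_def using dividend_less_div_times[of "4 * k * q" e] k q1 by (simp add: algebra_simps)
      also have "\<dots> \<le> (2 * m) * (4 * k * q)" using m by (intro mult_le_mono1) auto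
      finally have "e ^ c \<le> ((2 * m) * (4 * k * q)) ^ c" by (intro power_mono) auto
      also have "\<dots> = (8 * k) ^ c * (q ^ c * m ^ c)" 
      proof -
        have "(2 * m) * (4 * k * q) = (8 * k) * (q * m)" by simp
        then show ?thesis by (simp only: power_mult_distrib)
      qed
      \<comment> \<open>Only one factor \<open>q\<close> is needed to apply \<open>qm\<close>. The
        other \<open>c - 1\<close> are estimated by \<open>n\<close>, which makes the exponent
        \<open>(c - 1) + c\<close>.\<close>
      also have "q ^ c = q ^ (c - 1) * q" using c(1) by (subst power_minus_mult) auto
      also have "(8 * k) ^ c * (q ^ (c - 1) * q * m ^ c) = (8 * k) ^ c * (q ^ (c - 1) * (q * m ^ c))"
        by (simp only: mult.assoc)
      also have "\<dots> \<le> (8 * k) ^ c * (n ^ (c - 1) * (2 * K * (3 * n) ^ c * (k * l)))"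
        by (rule mult_le_mono[OF order.refl mult_le_mono[OF power_mono[OF qn le0] qm]])
      also have "\<dots> = 2 * k * ((8 * k) ^ c * 3 ^ c) * K * l * (n ^ (c - 1) * n ^ c)"
        by (simp only: power_mult_distrib mult_ac)
      also have "(8 * k) ^ c * 3 ^ c = (24 * k) ^ c"
        unfolding power_mult_distrib[symmetric] by simp
      also have "n ^ (c - 1) * n ^ c = n ^ (2 * c - 1)" 
        unfolding power_add[symmetric] using c(1) by (intro arg_cong[of _ _ "power n"]) simp
      finally show ?thesis .
    qed
    have "card E ^ c \<le> (l * e) ^ c" using El by (rule power_mono) simp
    also have "\<dots> = l ^ c * e ^ c" by (simp add: power_mult_distrib)
    also have "\<dots> \<le> l ^ c * (2 * k * (24 * k) ^ c * K * l * n ^ (2 * c - 1))" using key by (rule mult_le_mono2)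
    also have "\<dots> = 64 * k * (24 * k) ^ c * r * (l ^ c * l\<^sup>2 * l) * n ^ (2 * c - 1)"
      by (simp add: K_def mult_ac)
    \<comment> \<open>The logarithms add up as follows: \<open>c\<close> from restricting to a
      popular level, two from the sunflower bound, one from returning to all of \<open>E\<close> in
      the degree sum.\<close>
    also have "l ^ c * l\<^sup>2 * l = l ^ (k + 2)" by (simp add: c(2) power2_eq_square)
    also have "2 * c - 1 = 2 * k - 3" using c by simp
    finally show ?thesis by (simp only: c_def)
  qed
qed

lemma ex_binary_length:
  assumes n: "n \<ge> 2"
  shows "\<exists>l. n < 2 ^ l \<and> real l \<le> 4 * ln (real n)"
proof -
  obtain t where t: "2 ^ t \<le> n" "n < 2 ^ (t + 1)" using ex_power_ivl1[of 2 n] n by auto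
  have "t \<noteq> 0" using t n by (intro notI) auto
  \<comment> \<open>The constant 4 is this doubling, valid as \<open>t \<ge> 1\<close>, times the 2
    from \<open>ln 2 \<ge> 1 / 2\<close>.\<close>
  then have t1: "real t + 1 \<le> 2 * real t" by simp
  have "(2::real) ^ t \<le> real n" using t(1) by (metis of_nat_le_iff of_nat_numeral of_nat_power)
  then have "real t * ln 2 \<le> ln (real n)" using n by (simp add: ln_realpow[symmetric])
  moreover have "real t * (1 / 2) \<le> real t * ln 2"
  proof (rule mult_left_mono)
    have "exp (1 :: real) \<le> 2 powr 2" using exp_le by simp
    then have "1 \<le> 2 * ln (2 :: real)" by (simp add: powr_def)
    then show "1 / 2 \<le> ln (2 :: real)" by simp
  qed simp
  ultimately have "real t + 1 \<le> 4 * ln (real n)" using t1 by linarith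
  then have "real (t + 1) \<le> 4 * ln (real n)" by simp
  then show ?thesis using t by blast
qed

lemma max_edges_attained: "\<exists>E\<in>admissible_hypergraphs k r n. max_edges_no_regular k r n = card E"
proof -
  have "Max (card ` admissible_hypergraphs k r n) \<in> card ` admissible_hypergraphs k r n"
    using finite_admissible_hypergraphs[of k r n] empty_in_admissible_hypergraphs[of k r n]
    by (intro Max_in) auto
  then show ?thesis by (auto simp: max_edges_no_regular_def)
qed

text \<open>Taking the root of order \<open>k - 1\<close> turns the exponent
  \<open>2 * k - 3\<close> into \<open>2 - 1 / (k - 1)\<close> and the logarithmic exponent
  \<open>k + 2\<close> into \<open>C\<^sub>2\<close>.\<close>

lemma max_edges_upper_bound:
  assumes k: "k \<ge> 2" and r: "2 \<le> r" "r \<le> n"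
  shows "real (max_edges_no_regular k r n)
    \<le> (64 * real k * (24 * real k) ^ (k - 1) * 4 ^ (k + 2)) powr (1 / (real k - 1))
       * real r powr (1 / (real k - 1)) * real n powr (2 - 1 / (real k - 1))
       * ln (real n) powr (real (k + 2) / (real k - 1))"
proof -
  define c where "c = k - 1"
  have c: "c \<ge> 1" "real k - 1 = real c" using k by (auto simp: c_def of_nat_diff)
  define A where "A = 64 * real k * (24 * real k) ^ c * 4 ^ (k + 2)"
  have A: "A > 0" using k by (simp add: A_def)
  have lnn: "ln (real n) > 0" using r by simp
  obtain E where E: "E \<in> admissible_hypergraphs k r n" "max_edges_no_regular k r n = card E"
    using max_edges_attained by blast
  obtain l where l: "n < 2 ^ l" "real l \<le> 4 * ln (real n)"
    using ex_binary_length[of n] r by force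
  have "card E ^ c \<le> 64 * k * (24 * k) ^ c * r * l ^ (k + 2) * n ^ (2 * k - 3)"
    unfolding c_def using E(1) k r l
    by (intro card_edges_power_bound) (auto simp: admissible_hypergraphs_def)
  then have "real (card E ^ c) \<le> real (64 * k * (24 * k) ^ c * r * l ^ (k + 2) * n ^ (2 * k - 3))"
    by (rule of_nat_mono)
  then have "real (card E) ^ c \<le> 64 * real k * (24 * real k) ^ c * real r * real l ^ (k + 2) * real n ^ (2 * k - 3)"
    by simp
  also have "\<dots> \<le> 64 * real k * (24 * real k) ^ c * real r * (4 * ln (real n)) ^ (k + 2) * real n ^ (2 * k - 3)"
    using l(2) by (intro mult_right_mono mult_left_mono power_mono) auto
  also have "\<dots> = A * real r * ln (real n) ^ (k + 2) * real n ^ (2 * k - 3)"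
    by (simp add: A_def power_mult_distrib mult_ac)
  finally have *: "real (card E) ^ c \<le> A * real r * ln (real n) ^ (k + 2) * real n ^ (2 * k - 3)" .
  have "real (card E) = (real (card E) ^ c) powr (1 / real c)"
    using c(1) by (cases "card E = 0") (auto simp: powr_powr simp flip: powr_realpow)
  also have "\<dots> \<le> (A * real r * ln (real n) ^ (k + 2) * real n ^ (2 * k - 3)) powr (1 / real c)"
    using * by (intro powr_mono2) auto
  also have "\<dots> = A powr (1 / real c) * real r powr (1 / real c)
      * (ln (real n) ^ (k + 2)) powr (1 / real c) * (real n ^ (2 * k - 3)) powr (1 / real c)"
    using A lnn by (simp add: powr_mult)
  also have "(ln (real n) ^ (k + 2)) powr (1 / real c) = ln (real n) powr (real (k + 2) / real c)"
    using lnn by (simp add: powr_powr del: power_Suc flip: powr_realpow)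
  also have "(real n ^ (2 * k - 3)) powr (1 / real c) = real n powr (real (2 * k - 3) / real c)"
    using r by (simp add: powr_powr flip: powr_realpow)
  also have "real (2 * k - 3) / real c = 2 - 1 / real c"
    using k c by (simp add: c_def field_simps of_nat_diff)
  finally show ?thesis by (simp add: E(2) c(2) A_def c_def mult_ac)
qed

section \<open>The lower bound\<close>

text \<open>
  An index \<open>p = (x, t)\<close> gives the edge with vertices \<open>x\<close> in part \<open>0\<close>, \<open>t\<close> in part \<open>1\<close> and \<open>g (p, j)\<close> in part
  \<open>j \<ge> 2\<close>, where part \<open>j\<close> is the block \<open>{j * s..<j * s + s}\<close>.
\<close>

definition coord :: "((nat \<times> nat) \<times> nat \<Rightarrow> nat) \<Rightarrow> nat \<times> nat \<Rightarrow> nat \<Rightarrow> nat" where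
  "coord g p j = (if j = 0 then fst p else if j = 1 then snd p else g (p, j))"

definition coord_edge :: "nat \<Rightarrow> nat \<Rightarrow> ((nat \<times> nat) \<times> nat \<Rightarrow> nat) \<Rightarrow> nat \<times> nat \<Rightarrow> nat set" where
  "coord_edge k s g p = (\<lambda>j. j * s + coord g p j) ` {..<k}"

lemma block_eq_iff:
  fixes x y s :: nat
  assumes "x < s" "y < s"
  shows "i * s + x = j * s + y \<longleftrightarrow> i = j \<and> x = y"
proof
  assume *: "i * s + x = j * s + y"
  have "i = (i * s + x) div s" "j = (j * s + y) div s" using assms by auto
  then have "i = j" using * by simp
  then show "i = j \<and> x = y" using * by simp
qed simp

lemma mem_coord_edge_iff:
  assumes "\<And>j. j < k \<Longrightarrow> coord g p j < s" "j < k" "x < s"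
  shows "j * s + x \<in> coord_edge k s g p \<longleftrightarrow> coord g p j = x"
  using assms block_eq_iff[of x s] by (fastforce simp: coord_edge_def image_iff)

lemma card_coord_edge:
  assumes "\<And>j. j < k \<Longrightarrow> coord g p j < s"
  shows "card (coord_edge k s g p) = k"
  unfolding coord_edge_def using assms by (subst card_image) (auto simp: inj_on_def block_eq_iff)

lemma coord_edge_subset:
  assumes "\<And>j. j < k \<Longrightarrow> coord g p j < s"
  shows "coord_edge k s g p \<subseteq> {..<k * s}"
proof
  fix v assume "v \<in> coord_edge k s g p"
  then obtain j where j: "j < k" "v = j * s + coord g p j" by (auto simp: coord_edge_def)
  have "v < (j + 1) * s" using assms[OF j(1)] j by simp
  also have "\<dots> \<le> k * s" using j by (intro mult_le_mono1) auto
  finally show "v \<in> {..<k * s}" by simp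
qed

lemma card_coord_edge_Int:
  assumes p: "\<And>j. j < k \<Longrightarrow> coord g p j < s" and q: "\<And>j. j < k \<Longrightarrow> coord g q j < s"
  shows "card (coord_edge k s g p \<inter> coord_edge k s g q) = card {j \<in> {..<k}. coord g p j = coord g q j}"
proof -
  have "coord_edge k s g p \<inter> coord_edge k s g q = (\<lambda>j. j * s + coord g p j) ` {j \<in> {..<k}. coord g p j = coord g q j}"
  proof (intro equalityI subsetI)
    fix v assume v: "v \<in> coord_edge k s g p \<inter> coord_edge k s g q"
    then obtain i j where "i < k" "v = i * s + coord g p i" "j < k" "v = j * s + coord g q j"
      by (auto simp: coord_edge_def)
    then show "v \<in> (\<lambda>j. j * s + coord g p j) ` {j \<in> {..<k}. coord g p j = coord g q j}"
      using p q block_eq_iff[of "coord g p i" s "coord g q j" i j] by (intro image_eqI[of _ _ i]) auto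
  next
    fix v assume "v \<in> (\<lambda>j. j * s + coord g p j) ` {j \<in> {..<k}. coord g p j = coord g q j}"
    then obtain j where "j < k" "v = j * s + coord g p j" "v = j * s + coord g q j" by auto
    then show "v \<in> coord_edge k s g p \<inter> coord_edge k s g q"
      unfolding coord_edge_def by (intro IntI image_eqI[of _ _ j]) simp_all
  qed
  moreover have "inj_on (\<lambda>j. j * s + coord g p j) {j \<in> {..<k}. coord g p j = coord g q j}"
    by (rule inj_on_subset[of _ "{..<k}"]) (use p in \<open>auto simp: inj_on_def block_eq_iff\<close>)
  ultimately show ?thesis by (simp only: card_image)
qed

section \<open>Counting random extensions\<close>

text \<open>Restriction to \<open>I - D\<close> is injective on \<open>S\<close>. Read as
  probability: fixing the values on \<open>D\<close> costs \<open>s\<close> per point.\<close>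

lemma card_functions_determined:
  fixes I :: "'i set" and s :: nat
  assumes I: "finite I" and D: "D \<subseteq> I" and S: "S \<subseteq> I \<rightarrow>\<^sub>E {..<s}"
    and det: "\<And>g g'. g \<in> S \<Longrightarrow> g' \<in> S \<Longrightarrow> (\<And>i. i \<in> I - D \<Longrightarrow> g i = g' i) \<Longrightarrow> g = g'"
  shows "card S * s ^ card D \<le> s ^ card I"
proof -
  have "inj_on (\<lambda>g. restrict g (I - D)) S"
  proof (rule inj_onI)
    fix g g' assume *: "g \<in> S" "g' \<in> S" "restrict g (I - D) = restrict g' (I - D)"
    have "g i = g' i" if "i \<in> I - D" for i using fun_cong[OF *(3), of i] that by simp
    then show "g = g'" using det * by blast
  qed
  moreover have "(\<lambda>g. restrict g (I - D)) ` S \<subseteq> (I - D) \<rightarrow>\<^sub>E {..<s}"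
  proof (rule image_subsetI)
    fix g assume "g \<in> S"
    then have "g \<in> I \<rightarrow>\<^sub>E {..<s}" using S by blast
    then show "restrict g (I - D) \<in> (I - D) \<rightarrow>\<^sub>E {..<s}" by auto
  qed
  ultimately have "card S \<le> card ((I - D) \<rightarrow>\<^sub>E {..<s})"
    using I by (intro card_inj_on_le) (auto intro: finite_PiE)
  also have "\<dots> = s ^ (card I - card D)"
    using I D finite_subset[OF D I] by (simp add: card_PiE card_Diff_subset)
  finally have "card S * s ^ card D \<le> s ^ (card I - card D) * s ^ card D" by (rule mult_le_mono1)
  also have "\<dots> = s ^ card I" using card_mono[OF I D] by (simp flip: power_add)
  finally show ?thesis .
qed

text \<open>The values of \<open>g\<close> at \<open>(q, j)\<close> for \<open>j \<in> K\<close> are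
  dictated by those at \<open>(p, j)\<close>, so agreement on \<open>K\<close> has probability at
  most \<open>1 / s ^ card K\<close>.\<close>

lemma card_functions_agreeing:
  fixes J :: "'j set" and s :: nat
  assumes P: "finite P" and J: "finite J" and pq: "p \<in> P" "q \<in> P" "p \<noteq> q" and K: "K \<subseteq> J"
  shows "card {g \<in> (P \<times> J) \<rightarrow>\<^sub>E {..<s}. \<forall>j\<in>K. g (p, j) = g (q, j)} * s ^ card K \<le> s ^ card (P \<times> J)"
proof -
  have "card {g \<in> (P \<times> J) \<rightarrow>\<^sub>E {..<s}. \<forall>j\<in>K. g (p, j) = g (q, j)} * s ^ card ({q} \<times> K) \<le> s ^ card (P \<times> J)"
  proof (rule card_functions_determined)
    fix g g' assume *: "g \<in> {g \<in> (P \<times> J) \<rightarrow>\<^sub>E {..<s}. \<forall>j\<in>K. g (p, j) = g (q, j)}"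
      "g' \<in> {g \<in> (P \<times> J) \<rightarrow>\<^sub>E {..<s}. \<forall>j\<in>K. g (p, j) = g (q, j)}"
      "\<And>i. i \<in> P \<times> J - {q} \<times> K \<Longrightarrow> g i = g' i"
    show "g = g'"
    proof (rule PiE_ext)
      show "g \<in> (P \<times> J) \<rightarrow>\<^sub>E {..<s}" "g' \<in> (P \<times> J) \<rightarrow>\<^sub>E {..<s}" using * by auto
      fix i assume i: "i \<in> P \<times> J"
      show "g i = g' i"
      proof (cases "i \<in> {q} \<times> K")
        case True
        then obtain j where j: "i = (q, j)" "j \<in> K" by auto
        have "g (p, j) = g' (p, j)" using *(3)[of "(p, j)"] pq j i by auto
        then show ?thesis using *(1,2) j by auto
      qed (use i * in blast)
    qed
  qed (use P J pq K in auto)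
  then show ?thesis by (simp add: card_cartesian_product)
qed

lemma card_functions_into_blocks:
  fixes J :: "'j set" and s :: nat
  assumes P0: "finite P0" and J: "finite J" and P: "P \<subseteq> P0"
    and V: "\<And>j. j \<in> J \<Longrightarrow> V j \<subseteq> {..<s} \<and> card (V j) = m"
  shows "card {g \<in> (P0 \<times> J) \<rightarrow>\<^sub>E {..<s}. \<forall>p\<in>P. \<forall>j\<in>J. g (p, j) \<in> V j} * s ^ (card P * card J)
    = s ^ card (P0 \<times> J) * m ^ (card P * card J)"
proof -
  have eq: "{g \<in> (P0 \<times> J) \<rightarrow>\<^sub>E {..<s}. \<forall>p\<in>P. \<forall>j\<in>J. g (p, j) \<in> V j}
      = Pi\<^sub>E (P0 \<times> J) (\<lambda>i. if i \<in> P \<times> J then V (snd i) else {..<s})" (is "?L = ?R")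
  proof (intro equalityI subsetI)
    fix g assume "g \<in> ?L"
    then show "g \<in> ?R" by (auto simp: PiE_iff)
  next
    fix g assume g: "g \<in> ?R"
    have 1: "g (p, j) \<in> V j" if "p \<in> P" "j \<in> J" for p j
      using PiE_mem[OF g, of "(p, j)"] that P by auto
    have "g (p, j) < s" if "p \<in> P0" "j \<in> J" for p j
      using PiE_mem[OF g, of "(p, j)"] that V[of j] by (auto split: if_splits)
    then show "g \<in> ?L" using g 1 by (auto simp: PiE_iff)
  qed
  have sub: "P \<times> J \<subseteq> P0 \<times> J" using P by auto
  have finP: "finite P" using P P0 finite_subset by blast
  have "card ?L = (\<Prod>i\<in>P0 \<times> J. if i \<in> P \<times> J then m else s)"
    unfolding eq using P0 J V by (subst card_PiE) (auto intro!: prod.cong)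
  also have "\<dots> = m ^ card (P \<times> J) * s ^ card (P0 \<times> J - P \<times> J)"
  proof -
    have "{i \<in> P0 \<times> J. i \<in> P \<times> J} = P \<times> J" "P0 \<times> J \<inter> - (P \<times> J) = P0 \<times> J - P \<times> J" "P0 \<times> J \<inter> P \<times> J = P \<times> J"
      using sub by auto
    then show ?thesis using P0 J by (simp add: prod.If_cases)
  qed
  finally have "card ?L * s ^ card (P \<times> J) = m ^ card (P \<times> J) * s ^ (card (P0 \<times> J - P \<times> J) + card (P \<times> J))"
    by (simp add: power_add)
  also have "card (P0 \<times> J - P \<times> J) + card (P \<times> J) = card (P0 \<times> J)"
  proof -
    have f: "finite (P \<times> J)" "finite (P0 \<times> J)" using finP P0 J by auto
    show ?thesis using card_Diff_subset[OF f(1) sub] card_mono[OF f(2) sub] by simp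
  qed
  finally show ?thesis by (simp add: card_cartesian_product mult.commute)
qed

lemma binomial_mult_self_power_le: "(n choose m) * m ^ m \<le> (3 * n) ^ m"
proof -
  have "(n choose m) * m ^ m \<le> (n choose m) * (3 ^ m * fact m)"
    using power_self_le_fact by (rule mult_le_mono2)
  also have "\<dots> = 3 ^ m * ((n choose m) * fact m)" by simp
  also have "\<dots> \<le> 3 ^ m * n ^ m" using binomial_fact_pow by (rule mult_le_mono2)
  finally show ?thesis by (simp add: power_mult_distrib)
qed

text \<open>
  The left-hand side without \<open>4 ^ m\<close> over the right-hand side is the expected number of configurations with
  \<open>m\<close> vertices in each part and \<open>r * m\<close> edges. The hypothesis is the extreme case \<open>m = a\<close>.
\<close>

lemma configuration_count_le:
  assumes k: "k \<ge> 2" and r: "r \<ge> 2" and m: "1 \<le> m" "m \<le> a" and T: "T \<le> s"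
    and small: "4 * 3 ^ (k + r) * a ^ ((k - 1) * (r - 1)) * s ^ (k - 1) \<le> r ^ r * s ^ (r * (k - 2))"
  shows "(a choose m) * (T choose m) * (m * m choose (r * m)) * (s choose m) ^ (k - 2)
      * m ^ (r * m * (k - 2)) * 4 ^ m \<le> s ^ (r * m * (k - 2))"
proof -
  \<comment> \<open>After division by the \<open>m\<close>-powers in the binomial estimates, the
    exponent left over is \<open>r * k - (k + r) = d \<ge> 0\<close>. This makes
    \<open>m = a\<close> the worst case.\<close>
  define d where "d = (k - 1) * (r - 1) - 1"
  have "(k - 1) * (r - 1) \<ge> 1 * 1" using k r by (intro mult_le_mono) auto
  then have d: "(k - 1) * (r - 1) = Suc d" unfolding d_def by linarith
  obtain k' r' where kr: "k = Suc (Suc k')" "r = Suc (Suc r')"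
    using k r by (metis Suc_eq_plus1 add_2_eq_Suc le_Suc_ex)
  have rk: "r * k = (k + r) + d" using d unfolding kr by (simp add: algebra_simps)
  define N where "N = (a choose m) * (T choose m) * (m * m choose (r * m)) * (s choose m) ^ (k - 2) * m ^ (r * m * (k - 2))"
  \<comment> \<open>\<open>Z ^ m\<close> collects all denominators of the bounds
    \<open>(3 * n / m) ^ m\<close>: a factor \<open>m ^ m\<close> for each of the \<open>k\<close>
    parts and \<open>(r * m) ^ (r * m)\<close> for the edges.\<close>
  define Z where "Z = m ^ (k + r) * r ^ r"
  have Z: "Z > 0" using m r by (simp add: Z_def)
  have "N * 4 ^ m * Z ^ m = ((a choose m) * m ^ m) * ((T choose m) * m ^ m) * ((m * m choose (r * m)) * (r * m) ^ (r * m))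
      * ((s choose m) * m ^ m) ^ (k - 2) * m ^ (r * m * (k - 2)) * 4 ^ m"
  proof -
    have "Z ^ m = (m ^ (k + r)) ^ m * (r ^ r) ^ m" by (simp add: Z_def power_mult_distrib)
    also have "(m ^ (k + r)) ^ m = m ^ m * m ^ m * (m ^ m) ^ (k - 2) * m ^ (r * m)"
      unfolding kr power_mult[symmetric] power_add[symmetric]
      by (intro arg_cong[of _ _ "power m"]) (simp add: algebra_simps)
    also have "(r ^ r) ^ m = r ^ (r * m)" by (simp add: power_mult)
    finally show ?thesis by (simp add: N_def power_mult_distrib mult_ac)
  qed
  also have "\<dots> \<le> (3 * a) ^ m * (3 * s) ^ m * (3 * (m * m)) ^ (r * m) * ((3 * s) ^ m) ^ (k - 2) * m ^ (r * m * (k - 2)) * 4 ^ m"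
  proof -
    have "(T choose m) * m ^ m \<le> (3 * s) ^ m"
      using binomial_mult_self_power_le[of T m] T power_mono[of "3 * T" "3 * s" m] by linarith
    then show ?thesis
      by (intro mult_le_mono power_mono binomial_mult_self_power_le order.refl) auto
  qed
  also have "\<dots> = (4 * 3 ^ (k + r) * (a * s) * s ^ (k - 2) * m ^ (r * k)) ^ m"
  proof -
    have "m ^ (r * k) = (m * m) ^ r * m ^ (r * (k - 2))"
      unfolding kr power2_eq_square[symmetric] power_mult[symmetric] power_add[symmetric]
      by (intro arg_cong[of _ _ "power m"]) (simp add: algebra_simps)
    moreover have "(3::nat) ^ (k + r) = 3 * 3 * 3 ^ (k - 2) * 3 ^ r"
      unfolding kr by (simp add: power_add)
    ultimately have 1: "4 * 3 ^ (k + r) * (a * s) * s ^ (k - 2) * m ^ (r * k)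
        = (3 * a) * (3 * s) * (3 * (m * m)) ^ r * (3 * s) ^ (k - 2) * m ^ (r * (k - 2)) * 4"
      by (simp add: power_mult_distrib mult_ac)
    have 2: "((3 * s) ^ m) ^ (k - 2) = ((3 * s) ^ (k - 2)) ^ m"
      by (simp only: power_mult[symmetric] mult.commute)
    have 3: "m ^ (r * m * (k - 2)) = (m ^ (r * (k - 2))) ^ m"
      by (simp only: power_mult[symmetric] mult_ac)
    show ?thesis
      unfolding 1 2 3 power_mult[of _ r m] by (simp only: power_mult_distrib[symmetric])
  qed
  also have "\<dots> \<le> (s ^ (r * (k - 2)) * Z) ^ m"
  proof (rule power_mono)
    have "4 * 3 ^ (k + r) * (a * s) * s ^ (k - 2) * m ^ (r * k)
        = 4 * 3 ^ (k + r) * (a * m ^ d) * (s * s ^ (k - 2)) * m ^ (k + r)"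
      unfolding rk power_add[of m "k + r" d] by (simp only: mult_ac)
    also have "\<dots> \<le> 4 * 3 ^ (k + r) * (a * a ^ d) * (s * s ^ (k - 2)) * m ^ (k + r)"
      using m by (intro mult_le_mono power_mono order.refl) auto
    also have "a * a ^ d = a ^ ((k - 1) * (r - 1))" by (simp only: d power_Suc)
    also have "s * s ^ (k - 2) = s ^ (k - 1)" unfolding kr by simp
    also have "4 * 3 ^ (k + r) * a ^ ((k - 1) * (r - 1)) * s ^ (k - 1) * m ^ (k + r)
        \<le> r ^ r * s ^ (r * (k - 2)) * m ^ (k + r)"
      using small by (rule mult_le_mono1)
    finally show "4 * 3 ^ (k + r) * (a * s) * s ^ (k - 2) * m ^ (r * k) \<le> s ^ (r * (k - 2)) * Z"
      by (simp add: Z_def mult_ac)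
  qed simp
  also have "\<dots> = s ^ (r * m * (k - 2)) * Z ^ m"
    by (simp add: power_mult_distrib mult_ac flip: power_mult)
  finally show ?thesis using Z by (simp add: N_def)
qed

section \<open>Expected numbers of conflicts and configurations\<close>

definition conflicts :: "nat \<Rightarrow> (nat \<times> nat) set \<Rightarrow> ((nat \<times> nat) \<times> nat \<Rightarrow> nat) \<Rightarrow> ((nat \<times> nat) \<times> (nat \<times> nat)) set" where
  "conflicts k P g = {(p, q) \<in> P \<times> P. p \<noteq> q \<and> 2 \<le> card {j \<in> {..<k}. coord g p j = coord g q j}}"

text \<open>Distinct indices agree in at most one of the two deterministic parts. If they agree in
  one, a single random agreement is needed, with at most \<open>k\<close> choices of the part; if in
  none, two are needed, with at most \<open>k\<^sup>2\<close> choices. Adding the cases makes the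
  bound easy to sum over \<open>q\<close>.\<close>

lemma card_conflicting_functions_le:
  fixes k s :: nat and P :: "(nat \<times> nat) set"
  assumes P: "finite P" and pq: "p \<in> P" "q \<in> P" "p \<noteq> q" and s: "s > 0"
  defines "\<Omega> \<equiv> (P \<times> {2..<k}) \<rightarrow>\<^sub>E {..<s}"
  shows "real (card {g \<in> \<Omega>. 2 \<le> card {j \<in> {..<k}. coord g p j = coord g q j}})
    \<le> real (card \<Omega>) * ((if fst p = fst q then real k / real s else 0) + (if snd p = snd q then real k / real s else 0)
        + (real k / real s)\<^sup>2)"
    (is "real (card ?B) \<le> _")
proof -
  define J where "J = {2..<k}"
  have finJ: "finite J" and cardJ: "card J \<le> k" by (auto simp: J_def)
  have fin\<Omega>: "finite \<Omega>" unfolding \<Omega>_def using P by (intro finite_PiE) auto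
  define A where "A K = {g \<in> \<Omega>. \<forall>j\<in>K. g (p, j) = g (q, j)}" for K
  have finA: "finite (A K)" for K using fin\<Omega> by (simp add: A_def)
  have cardA: "real (card (A K)) \<le> real (card \<Omega>) / real s ^ card K" if "K \<subseteq> J" for K
  proof -
    have "card (A K) * s ^ card K \<le> s ^ card (P \<times> J)"
      unfolding A_def \<Omega>_def J_def[symmetric]
      using that by (intro card_functions_agreeing[OF P finJ pq]) 
    also have "\<dots> = card \<Omega>" unfolding \<Omega>_def J_def using P by (simp add: card_PiE)
    finally have "real (card (A K) * s ^ card K) \<le> real (card \<Omega>)" by (rule of_nat_mono)
    then show ?thesis using s by (simp add: field_simps)
  qed
  have two: "\<exists>i j. i < k \<and> j < k \<and> i \<noteq> j \<and> coord g p i = coord g q i \<and> coord g p j = coord g q j"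
    if "g \<in> ?B" for g
  proof (rule ccontr)
    assume "\<not> ?thesis"
    then have "card {j \<in> {..<k}. coord g p j = coord g q j} \<le> Suc 0"
      by (subst card_le_Suc0_iff_eq) auto
    then show False using that by simp
  qed
  show ?thesis
  proof (cases "fst p = fst q \<or> snd p = snd q")
    case True
    have "?B \<subseteq> (\<Union>j\<in>J. A {j})"
    proof
      fix g assume g: "g \<in> ?B"
      obtain i j where ij: "i < k" "j < k" "i \<noteq> j" "coord g p i = coord g q i" "coord g p j = coord g q j"
        using two[OF g] by blast
      have "\<not> (coord g p 0 = coord g q 0 \<and> coord g p 1 = coord g q 1)"
        using pq(3) by (auto simp: coord_def prod_eq_iff)
      then have "\<exists>i'\<in>{i, j}. i' \<noteq> 0 \<and> i' \<noteq> 1" using ij by (metis insertCI)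
      then obtain i' where "i' \<in> J" "coord g p i' = coord g q i'" "i' \<noteq> 0" "i' \<noteq> 1"
        using ij unfolding J_def by (auto simp: Suc_le_eq numeral_2_eq_2)
      then show "g \<in> (\<Union>j\<in>J. A {j})" using g by (auto simp: A_def coord_def)
    qed
    then have "card ?B \<le> card (\<Union>j\<in>J. A {j})" using finJ finA by (intro card_mono) auto
    also have "\<dots> \<le> (\<Sum>j\<in>J. card (A {j}))" by (rule card_UN_le[OF finJ])
    finally have "real (card ?B) \<le> real (\<Sum>j\<in>J. card (A {j}))" by (rule of_nat_mono)
    also have "\<dots> \<le> (\<Sum>j\<in>J. real (card \<Omega>) / real s)"
      unfolding of_nat_sum
    proof (rule sum_mono)
      fix j assume "j \<in> J"
      then show "real (card (A {j})) \<le> real (card \<Omega>) / real s" using cardA[of "{j}"] by simp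
    qed
    also have "\<dots> = real (card J) * (real (card \<Omega>) / real s)" by simp
    also have "\<dots> \<le> real k * (real (card \<Omega>) / real s)" using cardJ by (intro mult_right_mono) auto
    also have "\<dots> = real (card \<Omega>) * (real k / real s)" by simp
    also have "\<dots> \<le> real (card \<Omega>) * ((if fst p = fst q then real k / real s else 0) + (if snd p = snd q then real k / real s else 0)
        + (real k / real s)\<^sup>2)"
      using True by (intro mult_left_mono) auto
    finally show ?thesis .
  next
    case False
    define K where "K = {x \<in> J \<times> J. fst x \<noteq> snd x}"
    have finK: "finite K" and cardK: "card K \<le> k * k"
    proof -
      show "finite K" using finJ by (simp add: K_def)
      have "card K \<le> card (J \<times> J)" using finJ by (intro card_mono) (auto simp: K_def)
      also have "\<dots> \<le> k * k" using cardJ by (simp add: card_cartesian_product mult_le_mono)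
      finally show "card K \<le> k * k" .
    qed
    have "?B \<subseteq> (\<Union>x\<in>K. A {fst x, snd x})"
    proof
      fix g assume g: "g \<in> ?B"
      obtain i j where ij: "i < k" "j < k" "i \<noteq> j" "coord g p i = coord g q i" "coord g p j = coord g q j"
        using two[OF g] by blast
      have *: "i' \<in> J" "g (p, i') = g (q, i')" if "i' \<in> {i, j}" for i'
      proof -
        have "i' < k" and eq: "coord g p i' = coord g q i'" using that ij by auto
        moreover have "i' \<noteq> 0" using eq False by (intro notI) (simp add: coord_def)
        moreover have "i' \<noteq> 1" using eq False by (intro notI) (simp add: coord_def)
        ultimately show "i' \<in> J" "g (p, i') = g (q, i')" by (auto simp: J_def coord_def)
      qed
      have "(i, j) \<in> K" using *(1) ij by (simp add: K_def)
      moreover have "g \<in> A {i, j}" using g *(2) by (simp add: A_def)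
      ultimately show "g \<in> (\<Union>x\<in>K. A {fst x, snd x})" by force
    qed
    then have "card ?B \<le> card (\<Union>x\<in>K. A {fst x, snd x})" using finK finA by (intro card_mono) auto
    also have "\<dots> \<le> (\<Sum>x\<in>K. card (A {fst x, snd x}))" by (rule card_UN_le[OF finK])
    finally have "real (card ?B) \<le> real (\<Sum>x\<in>K. card (A {fst x, snd x}))" by (rule of_nat_mono)
    also have "\<dots> \<le> (\<Sum>x\<in>K. real (card \<Omega>) / (real s)\<^sup>2)"
      unfolding of_nat_sum
    proof (rule sum_mono)
      fix x assume "x \<in> K"
      then have "{fst x, snd x} \<subseteq> J" "card {fst x, snd x} = 2" by (auto simp: K_def)
      then show "real (card (A {fst x, snd x})) \<le> real (card \<Omega>) / (real s)\<^sup>2"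
        using cardA[of "{fst x, snd x}"] by simp
    qed
    also have "\<dots> = real (card K) * (real (card \<Omega>) / (real s)\<^sup>2)" by simp
    also have "\<dots> \<le> real (k * k) * (real (card \<Omega>) / (real s)\<^sup>2)"
      using of_nat_mono[OF cardK] by (intro mult_right_mono) auto
    also have "\<dots> = real (card \<Omega>) * (real k / real s)\<^sup>2" by (simp add: power2_eq_square)
    finally show ?thesis using False by simp
  qed
qed

text \<open>For fixed \<open>p\<close>, only \<open>T\<close> indices share its first entry and only
  \<open>a\<close> its second, so with \<open>u = k / s\<close> the row sum is
  \<open>T * u + a * u + a * T * u\<^sup>2\<close>. The 16 in the hypothesis gives
  \<open>u * T \<le> 1 / 32\<close>, which keeps it below \<open>1 / 8\<close>.\<close>

lemma sum_card_conflicts_le: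
  fixes k a T s :: nat
  assumes k: "k \<ge> 2" and a: "1 \<le> a" "a \<le> T" and T: "16 * k\<^sup>2 * T \<le> s"
  defines "P \<equiv> {..<a} \<times> {..<T}"
  defines "\<Omega> \<equiv> (P \<times> {2..<k}) \<rightarrow>\<^sub>E {..<s}"
  shows "(\<Sum>g\<in>\<Omega>. real (card (conflicts k P g))) \<le> real (a * T) * real (card \<Omega>) / 8"
proof -
  have finP: "finite P" by (simp add: P_def)
  have fin\<Omega>: "finite \<Omega>" unfolding \<Omega>_def using finP by (intro finite_PiE) auto
  have "0 < 16 * k\<^sup>2 * T" using k a by simp
  then have s: "s > 0" using T by linarith
  define u where "u = real k / real s"
  have u0: "u \<ge> 0" by (simp add: u_def)
  have uT: "u * real T \<le> 1 / 32"
  proof -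
    have "32 * k * T \<le> 16 * k\<^sup>2 * T" using k by (simp add: power2_eq_square)
    then have "real (32 * k * T) \<le> real s" using T by linarith
    then show ?thesis using s by (simp add: u_def field_simps)
  qed
  define w where "w p q = (if fst p = fst q then u else 0) + (if snd p = snd q then u else 0) + u\<^sup>2" for p q :: "nat \<times> nat"
  have w0: "w p q \<ge> 0" for p q using u0 by (simp add: w_def)
  have row: "(\<Sum>q\<in>P. w p q) \<le> 1 / 8" if p: "p \<in> P" for p
  proof -
    have 1: "{q \<in> P. fst p = fst q} = {fst p} \<times> {..<T}" "{q \<in> P. snd p = snd q} = {..<a} \<times> {snd p}"
      using p by (auto simp: P_def)
    have "(\<Sum>q\<in>P. w p q) = real (card {q \<in> P. fst p = fst q}) * u + real (card {q \<in> P. snd p = snd q}) * u + real (card P) * u\<^sup>2"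
      unfolding w_def sum.distrib sum.inter_filter[OF finP, symmetric] by simp
    also have "\<dots> = real T * u + real a * u + real a * real T * u\<^sup>2"
      unfolding 1 by (simp add: P_def card_cartesian_product)
    also have "\<dots> \<le> real T * u + real T * u + real T * real T * u\<^sup>2"
      using a u0 by (intro add_mono mult_right_mono) auto
    also have "\<dots> = 2 * (u * real T) + (u * real T) * (u * real T)" by (simp add: power2_eq_square)
    also have "\<dots> \<le> 2 * (1 / 32) + (1 / 32) * (1 / 32)"
      using uT u0 by (intro add_mono mult_mono) auto
    finally show ?thesis by simp
  qed
  have "(\<Sum>g\<in>\<Omega>. real (card (conflicts k P g)))
      = (\<Sum>g\<in>\<Omega>. \<Sum>x\<in>P \<times> P. if x \<in> conflicts k P g then 1 else 0)"
  proof (rule sum.cong)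
    fix g
    have *: "{x \<in> P \<times> P. x \<in> conflicts k P g} = conflicts k P g" by (auto simp: conflicts_def)
    have finPP: "finite (P \<times> P)" using finP by simp
    show "real (card (conflicts k P g)) = (\<Sum>x\<in>P \<times> P. if x \<in> conflicts k P g then 1 else 0)"
      unfolding sum.inter_filter[OF finPP, symmetric] * by simp
  qed simp
  also have "\<dots> = (\<Sum>x\<in>P \<times> P. \<Sum>g\<in>\<Omega>. if x \<in> conflicts k P g then 1 else 0)" by (rule sum.swap)
  also have "\<dots> = (\<Sum>x\<in>P \<times> P. real (card {g \<in> \<Omega>. x \<in> conflicts k P g}))"
    unfolding sum.inter_filter[OF fin\<Omega>, symmetric] by simp
  also have "\<dots> \<le> (\<Sum>x\<in>P \<times> P. real (card \<Omega>) * w (fst x) (snd x))"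
  proof (rule sum_mono)
    fix x assume x: "x \<in> P \<times> P"
    show "real (card {g \<in> \<Omega>. x \<in> conflicts k P g}) \<le> real (card \<Omega>) * w (fst x) (snd x)"
    proof (cases "fst x = snd x")
      case True
      then have *: "{g \<in> \<Omega>. x \<in> conflicts k P g} = {}" by (auto simp: conflicts_def)
      show ?thesis unfolding * using w0 by simp
    next
      case False
      have eq: "{g \<in> \<Omega>. x \<in> conflicts k P g}
          = {g \<in> \<Omega>. 2 \<le> card {j \<in> {..<k}. coord g (fst x) j = coord g (snd x) j}}"
        using x False by (auto simp: conflicts_def)
      show ?thesis unfolding eq unfolding w_def u_def \<Omega>_def
        by (rule card_conflicting_functions_le) (use x False finP s in auto)
    qed
  qed
  also have "\<dots> = real (card \<Omega>) * (\<Sum>p\<in>P. \<Sum>q\<in>P. w p q)"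
    unfolding sum.cartesian_product by (simp add: sum_distrib_left case_prod_beta)
  also have "\<dots> \<le> real (card \<Omega>) * (\<Sum>p\<in>P. 1 / 8)"
    by (intro mult_left_mono sum_mono row) auto
  also have "\<dots> = real (a * T) * real (card \<Omega>) / 8" by (simp add: P_def card_cartesian_product)
  finally show ?thesis .
qed

text \<open>A union bound over the \<open>m\<close>-element vertex sets in all parts and the
  \<open>r * m\<close> index pairs; level \<open>m\<close> contributes at most a fraction
  \<open>(1 / 4) ^ m\<close>.\<close>

lemma card_configured_functions_le:
  fixes k a T s :: nat
  assumes k: "k \<ge> 2" and r: "r \<ge> 2" and T: "T \<le> s" and s: "s > 0"
    and small: "4 * 3 ^ (k + r) * a ^ ((k - 1) * (r - 1)) * s ^ (k - 1) \<le> r ^ r * s ^ (r * (k - 2))"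
  defines "P\<^sub>0 \<equiv> {..<a} \<times> {..<T}"
  defines "\<Omega> \<equiv> (P\<^sub>0 \<times> {2..<k}) \<rightarrow>\<^sub>E {..<s}"
  shows "real (card {g \<in> \<Omega>. \<exists>m\<in>{1..a}. \<exists>P\<subseteq>P\<^sub>0. card P = r * m \<and> card (fst ` P) = m \<and> card (snd ` P) = m
      \<and> (\<forall>j\<in>{2..<k}. card ((\<lambda>p. g (p, j)) ` P) = m)}) \<le> real (card \<Omega>) / 3"
    (is "real (card ?B) \<le> _")
proof -
  define J where "J = {2..<k}"
  have finJ: "finite J" and cardJ: "card J = k - 2" by (auto simp: J_def)
  have finP0: "finite P\<^sub>0" by (simp add: P\<^sub>0_def)
  have fin\<Omega>: "finite \<Omega>" unfolding \<Omega>_def using finP0 by (intro finite_PiE) auto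
  \<comment> \<open>Choosing the sets in the first two parts before \<open>P\<close> makes
    \<open>P\<close> a set of pairs among \<open>m * m\<close>, not among
    \<open>a * T\<close>.\<close>
  define Z where "Z m = (SIGMA XY : {X. X \<subseteq> {..<a} \<and> card X = m} \<times> {Y. Y \<subseteq> {..<T} \<and> card Y = m}.
      {P. P \<subseteq> fst XY \<times> snd XY \<and> card P = r * m} \<times> (J \<rightarrow>\<^sub>E {V. V \<subseteq> {..<s} \<and> card V = m}))" for m
  define S where "S = (\<lambda>(XY :: nat set \<times> nat set, P, V). {g \<in> \<Omega>. \<forall>p\<in>P. \<forall>j\<in>J. g (p, j) \<in> V j})"
  have fin_inner: "finite ({P. P \<subseteq> fst XY \<times> snd XY \<and> card P = r * m} \<times> (J \<rightarrow>\<^sub>E {V. V \<subseteq> {..<s} \<and> card V = m}))"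
    if XY: "XY \<in> {X. X \<subseteq> {..<a} \<and> card X = m} \<times> {Y. Y \<subseteq> {..<T} \<and> card Y = m}"
    for XY :: "nat set \<times> nat set" and m
  proof (intro finite_cartesian_product finite_PiE finJ)
    have "finite (fst XY)" by (rule finite_subset[of _ "{..<a}"]) (use XY in auto)
    moreover have "finite (snd XY)" by (rule finite_subset[of _ "{..<T}"]) (use XY in auto)
    ultimately have "finite (fst XY \<times> snd XY)" by simp
    then show "finite {P. P \<subseteq> fst XY \<times> snd XY \<and> card P = r * m}" by simp
  qed simp
  have finZ: "finite (Z m)" for m
    unfolding Z_def by (intro finite_SigmaI fin_inner) auto
  have cardZ: "card (Z m) = (a choose m) * (T choose m) * (m * m choose (r * m)) * (s choose m) ^ (k - 2)" for m
  proof -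
    have "card (Z m) = (\<Sum>XY\<in>{X. X \<subseteq> {..<a} \<and> card X = m} \<times> {Y. Y \<subseteq> {..<T} \<and> card Y = m}.
        card ({P. P \<subseteq> fst XY \<times> snd XY \<and> card P = r * m} \<times> (J \<rightarrow>\<^sub>E {V. V \<subseteq> {..<s} \<and> card V = m})))"
      unfolding Z_def by (intro card_SigmaI ballI fin_inner) auto
    also have "\<dots> = (\<Sum>XY\<in>{X. X \<subseteq> {..<a} \<and> card X = m} \<times> {Y. Y \<subseteq> {..<T} \<and> card Y = m}.
        (m * m choose (r * m)) * (s choose m) ^ (k - 2))"
    proof (rule sum.cong)
      fix XY assume XY: "XY \<in> {X. X \<subseteq> {..<a} \<and> card X = m} \<times> {Y. Y \<subseteq> {..<T} \<and> card Y = m}"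
      have "finite (fst XY)" by (rule finite_subset[of _ "{..<a}"]) (use XY in auto)
      moreover have "finite (snd XY)" by (rule finite_subset[of _ "{..<T}"]) (use XY in auto)
      ultimately have "finite (fst XY \<times> snd XY)" "card (fst XY \<times> snd XY) = m * m"
        using XY by (auto simp: card_cartesian_product)
      then show "card ({P. P \<subseteq> fst XY \<times> snd XY \<and> card P = r * m} \<times> (J \<rightarrow>\<^sub>E {V. V \<subseteq> {..<s} \<and> card V = m}))
          = (m * m choose (r * m)) * (s choose m) ^ (k - 2)"
        using finJ by (simp add: card_cartesian_product n_subsets card_PiE cardJ)
    qed simp
    finally show ?thesis by (simp add: card_cartesian_product n_subsets)
  qed
  have cardS: "real (card (S c)) = real (card \<Omega>) * (real m ^ (r * m * (k - 2)) / real s ^ (r * m * (k - 2)))"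
    if c: "c \<in> Z m" for c m
  proof -
    obtain X Y P V where c': "c = ((X, Y), P, V)" by (metis prod.collapse)
    have XY: "X \<subseteq> {..<a}" "Y \<subseteq> {..<T}" "P \<subseteq> X \<times> Y" and cP: "card P = r * m"
      and V: "\<And>j. j \<in> J \<Longrightarrow> V j \<subseteq> {..<s} \<and> card (V j) = m"
      using c unfolding c' Z_def by auto
    have P: "P \<subseteq> P\<^sub>0" using XY unfolding P\<^sub>0_def by blast
    have "card (S c) * s ^ (card P * card J) = s ^ card (P\<^sub>0 \<times> J) * m ^ (card P * card J)"
      unfolding c' S_def \<Omega>_def J_def[symmetric] prod.case
      by (rule card_functions_into_blocks[OF finP0 finJ P V])
    moreover have "card \<Omega> = s ^ card (P\<^sub>0 \<times> J)"
      unfolding \<Omega>_def J_def using finP0 by (simp add: card_PiE)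
    ultimately have "card (S c) * s ^ (r * m * (k - 2)) = card \<Omega> * m ^ (r * m * (k - 2))"
      by (simp add: cP cardJ)
    then have "real (card (S c)) * real s ^ (r * m * (k - 2)) = real (card \<Omega>) * real m ^ (r * m * (k - 2))"
      by (metis of_nat_mult of_nat_power)
    then show ?thesis using s by (simp add: field_simps)
  qed
  have level: "(\<Sum>c\<in>Z m. real (card (S c))) \<le> real (card \<Omega>) * (1 / 4) ^ m" if m: "m \<in> {1..a}" for m
  proof -
    define Q where "Q = real s ^ (r * m * (k - 2))"
    have Q: "Q > 0" using s by (simp add: Q_def)
    have "card (Z m) * m ^ (r * m * (k - 2)) * 4 ^ m \<le> s ^ (r * m * (k - 2))"
      unfolding cardZ using configuration_count_le[OF k r _ _ T small] m by simp
    then have "real (card (Z m) * m ^ (r * m * (k - 2)) * 4 ^ m) \<le> real (s ^ (r * m * (k - 2)))"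
      by (rule of_nat_mono)
    then have *: "real (card (Z m)) * real m ^ (r * m * (k - 2)) * 4 ^ m \<le> Q" by (simp add: Q_def)
    have "(\<Sum>c\<in>Z m. real (card (S c))) = (\<Sum>c\<in>Z m. real (card \<Omega>) * (real m ^ (r * m * (k - 2)) / Q))"
      unfolding Q_def by (intro sum.cong refl cardS)
    also have "\<dots> = real (card \<Omega>) * (real (card (Z m)) * real m ^ (r * m * (k - 2)) / Q)" by simp
    also have "\<dots> \<le> real (card \<Omega>) * (1 / 4) ^ m"
      using * Q by (intro mult_left_mono) (auto simp: field_simps)
    finally show ?thesis .
  qed
  \<comment> \<open>The subtracted term strengthens the claim enough for the induction.\<close>
  have geom: "(\<Sum>m\<in>{1..b}. (1 / 4 :: real) ^ m) \<le> 1 / 3 - (1 / 4) ^ b / 3" for b :: nat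
    by (induction b) auto
  have "?B \<subseteq> (\<Union>m\<in>{1..a}. \<Union>c\<in>Z m. S c)"
  proof
    fix g assume "g \<in> ?B"
    then obtain m P where g: "g \<in> \<Omega>" and m: "m \<in> {1..a}" and P: "P \<subseteq> P\<^sub>0" "card P = r * m"
      "card (fst ` P) = m" "card (snd ` P) = m" "\<And>j. j \<in> J \<Longrightarrow> card ((\<lambda>p. g (p, j)) ` P) = m"
      unfolding J_def by blast
    define V where "V = (\<lambda>j\<in>J. (\<lambda>p. g (p, j)) ` P)"
    have val: "g (p, j) < s" if "p \<in> P" "j \<in> J" for p j
      using g that P(1) unfolding \<Omega>_def J_def by (auto dest: PiE_mem)
    have "((fst ` P, snd ` P), P, V) \<in> Z m"
      unfolding Z_def
    proof (intro SigmaI CollectI conjI PiE_I)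
      show "fst ` P \<subseteq> {..<a}" "snd ` P \<subseteq> {..<T}" using P(1) by (auto simp: P\<^sub>0_def)
      show "P \<subseteq> fst (fst ` P, snd ` P) \<times> snd (fst ` P, snd ` P)" by force
    qed (use P val in \<open>auto simp: V_def\<close>)
    moreover have "g \<in> S ((fst ` P, snd ` P), P, V)"
      using g by (auto simp: S_def V_def)
    ultimately show "g \<in> (\<Union>m\<in>{1..a}. \<Union>c\<in>Z m. S c)" using m by blast
  qed
  moreover have finS: "finite (S c)" for c using fin\<Omega> by (auto simp: S_def case_prod_beta)
  ultimately have "card ?B \<le> card (\<Union>m\<in>{1..a}. \<Union>c\<in>Z m. S c)"
    using finZ by (intro card_mono finite_UN_I) auto
  also have "\<dots> \<le> (\<Sum>m\<in>{1..a}. card (\<Union>c\<in>Z m. S c))" by (rule card_UN_le) simp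
  also have "\<dots> \<le> (\<Sum>m\<in>{1..a}. \<Sum>c\<in>Z m. card (S c))" by (intro sum_mono card_UN_le finZ)
  finally have "real (card ?B) \<le> real (\<Sum>m\<in>{1..a}. \<Sum>c\<in>Z m. card (S c))" by (rule of_nat_mono)
  also have "\<dots> = (\<Sum>m\<in>{1..a}. \<Sum>c\<in>Z m. real (card (S c)))" by simp
  also have "\<dots> \<le> (\<Sum>m\<in>{1..a}. real (card \<Omega>) * (1 / 4) ^ m)" by (intro sum_mono level)
  also have "\<dots> = real (card \<Omega>) * (\<Sum>m\<in>{1..a}. (1 / 4) ^ m)" by (simp add: sum_distrib_left)
  also have "\<dots> \<le> real (card \<Omega>) * (1 / 3)"
  proof (rule mult_left_mono)
    have "(0::real) \<le> (1 / 4) ^ a / 3" by simp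
    then show "(\<Sum>m\<in>{1..a}. (1 / 4 :: real) ^ m) \<le> 1 / 3" using geom[of a] by linarith
  qed simp
  finally show ?thesis by simp
qed

section \<open>Extracting a hypergraph and choosing the parameters\<close>

text \<open>Double counting in part \<open>j\<close>: every edge has exactly one vertex there, and
  every vertex used lies on \<open>r\<close> edges.\<close>

lemma regular_subhypergraph_imp_configuration:
  assumes lt: "\<And>p j. p \<in> P\<^sub>0 \<Longrightarrow> j < k \<Longrightarrow> coord g p j < s" and fin: "finite P\<^sub>0" and k: "k \<ge> 2"
    and sub: "P \<subseteq> P\<^sub>0" and inj: "inj_on (coord_edge k s g) P\<^sub>0"
    and reg: "regular_hypergraph r (coord_edge k s g ` P)" and r: "r \<ge> 1" and j: "j < k"
  shows "card P = r * card ((\<lambda>p. coord g p j) ` P)"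
proof -
  have finP: "finite P" using fin sub finite_subset by blast
  have deg: "card {p \<in> P. coord g p j = x} = r" if x: "x \<in> (\<lambda>p. coord g p j) ` P" for x
  proof -
    obtain p where p: "p \<in> P" "x = coord g p j" using x by blast
    have xs: "x < s" using p lt sub j by blast
    have mem: "j * s + x \<in> coord_edge k s g q \<longleftrightarrow> coord g q j = x" if "q \<in> P" for q
    proof -
      have "q \<in> P\<^sub>0" using that sub by blast
      then show ?thesis using lt xs j by (intro mem_coord_edge_iff) blast+
    qed
    have "vertex_degree (coord_edge k s g ` P) (j * s + x) = r"
      using reg mem[OF p(1)] p unfolding regular_hypergraph_def by blast
    moreover have "{f \<in> coord_edge k s g ` P. j * s + x \<in> f} = coord_edge k s g ` {p \<in> P. coord g p j = x}"
      using mem by auto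
    moreover have "inj_on (coord_edge k s g) {p \<in> P. coord g p j = x}"
      by (rule inj_on_subset[OF inj]) (use sub in auto)
    ultimately show ?thesis by (simp add: vertex_degree_def card_image)
  qed
  have "card P = (\<Sum>x\<in>(\<lambda>p. coord g p j) ` P. \<Sum>p\<in>{p \<in> P. coord g p j = x}. 1)"
    using finP by (subst sum.group) auto
  also have "\<dots> = (\<Sum>x\<in>(\<lambda>p. coord g p j) ` P. r)" by (intro sum.cong) (auto simp: deg)
  finally show ?thesis by simp
qed

lemma exists_linear_hypergraph_without_regular:
  fixes k a T s :: nat
  assumes k: "k \<ge> 2" and r: "r \<ge> 2" and a: "1 \<le> a" "a \<le> T" and T: "16 * k\<^sup>2 * T \<le> s"
    and small: "4 * 3 ^ (k + r) * a ^ ((k - 1) * (r - 1)) * s ^ (k - 1) \<le> r ^ r * s ^ (r * (k - 2))"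
  shows "\<exists>E. uniform_hypergraph k {..<k * s} E \<and> linear_hypergraph E
    \<and> \<not> has_regular_subhypergraph r E \<and> a * T \<le> 2 * card E"
proof -
  define P\<^sub>0 where "P\<^sub>0 = {..<a} \<times> {..<T}"
  define \<Omega> where "\<Omega> = (P\<^sub>0 \<times> {2..<k}) \<rightarrow>\<^sub>E {..<s}"
  have finP0: "finite P\<^sub>0" and cardP0: "card P\<^sub>0 = a * T" by (auto simp: P\<^sub>0_def card_cartesian_product)
  have fin\<Omega>: "finite \<Omega>" unfolding \<Omega>_def using finP0 by (intro finite_PiE) auto
  have "1 * T \<le> 16 * k\<^sup>2 * T" using k by (intro mult_le_mono1) (simp add: power2_eq_square)
  then have Ts: "T \<le> s" and s: "s > 0" using T a by linarith+
  have "s ^ card (P\<^sub>0 \<times> {2..<k}) > 0" using s by simp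
  then have \<Omega>_pos: "card \<Omega> > 0" unfolding \<Omega>_def using finP0 by (simp add: card_PiE)
  define conf where "conf g = card (conflicts k P\<^sub>0 g)" for g
  define B1 where "B1 = {g \<in> \<Omega>. a * T < 2 * conf g}"
  define B2 where "B2 = {g \<in> \<Omega>. \<exists>m\<in>{1..a}. \<exists>P\<subseteq>P\<^sub>0. card P = r * m \<and> card (fst ` P) = m \<and> card (snd ` P) = m
      \<and> (\<forall>j\<in>{2..<k}. card ((\<lambda>p. g (p, j)) ` P) = m)}"
  \<comment> \<open>Markov's inequality: the mean is at most \<open>a * T / 8\<close>, so at most a
    quarter of the functions lie in \<open>B1\<close>. With at most a third in \<open>B2\<close>,
    some \<open>g\<close> avoids both.\<close>
  have "real (card B1) * (real (a * T) / 2) = (\<Sum>g\<in>B1. real (a * T) / 2)" by simp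
  also have "\<dots> \<le> (\<Sum>g\<in>B1. real (conf g))"
  proof (rule sum_mono)
    fix g assume "g \<in> B1"
    then have "real (a * T) \<le> real (2 * conf g)" unfolding B1_def by (intro of_nat_mono) auto
    then show "real (a * T) / 2 \<le> real (conf g)" by simp
  qed
  also have "\<dots> \<le> (\<Sum>g\<in>\<Omega>. real (conf g))" using fin\<Omega> by (intro sum_mono2) (auto simp: B1_def)
  also have "\<dots> \<le> real (a * T) * real (card \<Omega>) / 8"
    unfolding conf_def \<Omega>_def P\<^sub>0_def by (rule sum_card_conflicts_le[OF k a T])
  finally have "real (card B1) * real (a * T) \<le> (real (card \<Omega>) / 4) * real (a * T)"
    by (simp add: algebra_simps)
  moreover have "real (a * T) > 0" using a by simp
  ultimately have B1: "real (card B1) \<le> real (card \<Omega>) / 4" by (simp only: mult_le_cancel_right_pos)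
  have B2: "real (card B2) \<le> real (card \<Omega>) / 3"
    unfolding B2_def \<Omega>_def P\<^sub>0_def by (rule card_configured_functions_le[OF k r Ts s small])
  have "card (B1 \<union> B2) \<le> card B1 + card B2" by (rule card_Un_le)
  then have "real (card (B1 \<union> B2)) < real (card \<Omega>)" using B1 B2 \<Omega>_pos by linarith
  then have "card (B1 \<union> B2) < card \<Omega>" by simp
  then have "\<not> \<Omega> \<subseteq> B1 \<union> B2"
    using card_mono[of "B1 \<union> B2" \<Omega>] fin\<Omega> by (auto simp: B1_def B2_def)
  then obtain g where g: "g \<in> \<Omega>" "g \<notin> B1" "g \<notin> B2" by blast
  \<comment> \<open>\<open>conflicts\<close> is symmetric, so taking first components deletes both
    ends of every conflict. Deletion cannot create a configuration, because \<open>B2\<close>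
    already refers to all subsets of the index set.\<close>
  define Good where "Good = P\<^sub>0 - fst ` conflicts k P\<^sub>0 g"
  define ed where "ed = coord_edge k s g"
  have lt: "coord g p j < s" if "p \<in> P\<^sub>0" "j < k" for p j
  proof -
    have "fst p < s" "snd p < s" using that a Ts by (auto simp: P\<^sub>0_def)
    moreover have "g (p, j) < s" if "j \<noteq> 0" "j \<noteq> 1"
    proof -
      have "(p, j) \<in> P\<^sub>0 \<times> {2..<k}" using that \<open>p \<in> P\<^sub>0\<close> \<open>j < k\<close> by auto
      then show ?thesis using g(1) unfolding \<Omega>_def by (auto dest: PiE_mem)
    qed
    ultimately show ?thesis by (simp add: coord_def)
  qed
  have inj: "inj_on ed P\<^sub>0"
  proof (rule inj_onI)
    fix p q assume *: "p \<in> P\<^sub>0" "q \<in> P\<^sub>0" "ed p = ed q"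
    have "coord g q j = coord g p j" if "j < k" for j
    proof -
      have "j * s + coord g p j \<in> ed q" using *(3) that by (auto simp: ed_def coord_edge_def)
      then show ?thesis using mem_coord_edge_iff[of k g q s j "coord g p j"] lt * that by (simp add: ed_def)
    qed
    from this[of 0] this[of 1] show "p = q" using k by (simp add: coord_def prod_eq_iff)
  qed
  have GoodP0: "Good \<subseteq> P\<^sub>0" by (auto simp: Good_def)
  have "uniform_hypergraph k {..<k * s} (ed ` Good)"
    unfolding uniform_hypergraph_def ed_def
    using card_coord_edge coord_edge_subset lt GoodP0 by blast
  moreover have "linear_hypergraph (ed ` Good)"
    unfolding linear_hypergraph_def
  proof (intro ballI impI)
    fix e e' assume "e \<in> ed ` Good" "e' \<in> ed ` Good" "e \<noteq> e'"
    then obtain p q where pq: "p \<in> Good" "q \<in> Good" "e = ed p" "e' = ed q" "p \<noteq> q" by blast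
    have P0: "p \<in> P\<^sub>0" "q \<in> P\<^sub>0" using pq GoodP0 by auto
    have "(p, q) \<notin> conflicts k P\<^sub>0 g" using pq(1) unfolding Good_def by force
    then have "card {j \<in> {..<k}. coord g p j = coord g q j} \<le> 1"
      using pq(5) P0 unfolding conflicts_def by simp
    moreover have "card (e \<inter> e') = card {j \<in> {..<k}. coord g p j = coord g q j}"
      unfolding pq ed_def using lt P0 by (intro card_coord_edge_Int) auto
    ultimately show "card (e \<inter> e') \<le> 1" by simp
  qed
  moreover have "\<not> has_regular_subhypergraph r (ed ` Good)"
  proof
    assume "has_regular_subhypergraph r (ed ` Good)"
    then obtain F where F: "F \<subseteq> ed ` Good" "regular_hypergraph r F" unfolding has_regular_subhypergraph_def by blast
    obtain P where P: "P \<subseteq> Good" "F = ed ` P" using F(1) by (meson subset_image_iff)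
    have PP0: "P \<subseteq> P\<^sub>0" using P GoodP0 by blast
    have finP: "finite P" using PP0 finP0 finite_subset by blast
    have Pne: "P \<noteq> {}" using F(2) P(2) by (auto simp: regular_hypergraph_def)
    have c: "card P = r * card ((\<lambda>p. coord g p j) ` P)" if "j < k" for j
      using regular_subhypergraph_imp_configuration[OF lt finP0 k PP0 _ _ _ that] inj F(2) r
      unfolding ed_def P(2) by simp
    define m where "m = card (fst ` P)"
    have "(\<lambda>p. coord g p 0) ` P = fst ` P" "(\<lambda>p. coord g p 1) ` P = snd ` P" by (simp_all add: coord_def)
    then have c0: "card P = r * m" and c1: "card P = r * card (snd ` P)"
      using c[of 0] c[of 1] k by (simp_all add: m_def)
    have "card (snd ` P) = m" using c0 c1 r by simp
    moreover have "card ((\<lambda>p. g (p, j)) ` P) = m" if "j \<in> {2..<k}" for j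
    proof -
      have "(\<lambda>p. coord g p j) ` P = (\<lambda>p. g (p, j)) ` P" using that by (simp add: coord_def)
      then have "card P = r * card ((\<lambda>p. g (p, j)) ` P)" using c[of j] that by simp
      then show ?thesis using c0 r by simp
    qed
    moreover have "m \<in> {1..a}"
    proof -
      have "m \<noteq> 0" using Pne finP by (simp add: m_def)
      moreover have "m \<le> card {..<a}" unfolding m_def using PP0 by (intro card_mono) (auto simp: P\<^sub>0_def)
      ultimately show ?thesis by simp
    qed
    ultimately have "g \<in> B2" using g(1) PP0 c0 unfolding B2_def m_def by blast
    then show False using g(3) by blast
  qed
  moreover have "a * T \<le> 2 * card (ed ` Good)"
  proof -
    have finC: "finite (conflicts k P\<^sub>0 g)"
      by (rule finite_subset[of _ "P\<^sub>0 \<times> P\<^sub>0"]) (use finP0 in \<open>auto simp: conflicts_def\<close>)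
    have "fst ` conflicts k P\<^sub>0 g \<subseteq> P\<^sub>0" by (auto simp: conflicts_def)
    then have "card Good = a * T - card (fst ` conflicts k P\<^sub>0 g)"
      unfolding Good_def using finC by (simp add: card_Diff_subset cardP0)
    moreover have "card (fst ` conflicts k P\<^sub>0 g) \<le> conf g"
      unfolding conf_def using finC by (rule card_image_le)
    moreover have "2 * conf g \<le> a * T" using g(1,2) by (auto simp: B1_def)
    moreover have "card (ed ` Good) = card Good"
      using inj_on_subset[OF inj GoodP0] by (rule card_image)
    ultimately show ?thesis by linarith
  qed
  ultimately show ?thesis by blast
qed

lemma card_le_max_edges:
  assumes "uniform_hypergraph k {..<n} E" "linear_hypergraph E" "\<not> has_regular_subhypergraph r E"
  shows "card E \<le> max_edges_no_regular k r n"
  unfolding max_edges_no_regular_def using assms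
  by (intro Max_ge finite_imageI finite_admissible_hypergraphs) (auto simp: admissible_hypergraphs_def)

text \<open>Disjoint consecutive blocks form a matching, where no degree reaches 2. This covers the
  case in which the random construction would have an empty first part.\<close>

lemma div_le_max_edges:
  assumes k: "k \<ge> 1" and r: "r \<ge> 2"
  shows "n div k \<le> max_edges_no_regular k r n"
proof -
  define B where "B i = {i * k..<(i + 1) * k}" for i
  have mem: "v \<in> B i \<longleftrightarrow> v div k = i" for v i
  proof
    assume "v \<in> B i"
    then show "v div k = i" by (intro div_nat_eqI) (auto simp: B_def mult.commute)
  next
    assume "v div k = i"
    then have "v = i * k + v mod k" using div_mult_mod_eq[of v k] by simp
    moreover have "v mod k < k" using k by simp
    ultimately have "i * k \<le> v" "v < i * k + k" by linarith+
    then show "v \<in> B i" by (simp add: B_def)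
  qed
  have cardB: "card (B i) = k" for i by (simp add: B_def)
  have inj: "inj_on B {..<n div k}"
  proof (rule inj_onI)
    fix i j assume "B i = B j"
    moreover have "i * k \<in> B i" using k by (simp add: mem)
    ultimately show "i = j" using k mem[of "i * k" j] by simp
  qed
  have deg: "card {f \<in> F. v \<in> f} \<le> 1" if "F \<subseteq> B ` {..<n div k}" for F v
  proof -
    have "{f \<in> F. v \<in> f} \<subseteq> {B (v div k)}" using that mem by auto
    then have "card {f \<in> F. v \<in> f} \<le> card {B (v div k)}" by (intro card_mono) auto
    then show ?thesis by simp
  qed
  have "card (B ` {..<n div k}) \<le> max_edges_no_regular k r n"
  proof (rule card_le_max_edges)
    show "uniform_hypergraph k {..<n} (B ` {..<n div k})"
      unfolding uniform_hypergraph_def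
    proof (intro ballI conjI)
      fix e assume "e \<in> B ` {..<n div k}"
      then obtain i where i: "i < n div k" "e = B i" by auto
      have "(i + 1) * k \<le> (n div k) * k" using i by (intro mult_le_mono1) auto
      also have "\<dots> \<le> n" by simp
      finally show "e \<subseteq> {..<n}" using i by (auto simp: B_def)
      show "card e = k" using i cardB by simp
    qed
    show "linear_hypergraph (B ` {..<n div k})"
      unfolding linear_hypergraph_def
    proof (intro ballI impI)
      fix e e' assume "e \<in> B ` {..<n div k}" "e' \<in> B ` {..<n div k}" "e \<noteq> e'"
      then have *: "e \<inter> e' = {}" using mem by auto
      show "card (e \<inter> e') \<le> 1" unfolding * by simp
    qed
    show "\<not> has_regular_subhypergraph r (B ` {..<n div k})"
    proof
      assume "has_regular_subhypergraph r (B ` {..<n div k})"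
      then obtain F where F: "F \<subseteq> B ` {..<n div k}" "F \<noteq> {}" "\<And>v. v \<in> \<Union>F \<Longrightarrow> vertex_degree F v = r"
        by (auto simp: has_regular_subhypergraph_def regular_hypergraph_def)
      then obtain i where "B i \<in> F" by blast
      moreover have "i * k \<in> B i" using k by (simp add: mem)
      ultimately have "vertex_degree F (i * k) = r" using F(3) by blast
      then show False using deg[OF F(1), of "i * k"] r by (simp add: vertex_degree_def)
    qed
  qed
  then show ?thesis using inj by (simp add: card_image)
qed

text \<open>In \<open>46656 = 64 * 3 ^ 6\<close>, the factor 64 together with \<open>k ^ 4\<close>
  ensures \<open>a \<le> T\<close>, and \<open>3 ^ 6\<close> absorbs the constants of the union
  bound. The divisor \<open>512 * k ^ 4\<close> is \<open>4 * k\<^sup>2\<close>, from passing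
  between \<open>n\<close> and \<open>s\<close>, times \<open>128 * k\<^sup>2\<close>, from rounding
  and from keeping only half of the edges.\<close>

lemma max_edges_lower_bound:
  assumes k: "k \<ge> 2" and r: "2 \<le> r" "r \<le> n" and kn: "k \<le> n"
  defines "\<theta> \<equiv> 1 / (46656 * real k ^ 4)"
  shows "\<theta> / (512 * real k ^ 4) * real r powr (1 / (real k - 1))
      * real n powr (2 - real r / ((real r - 1) * (real k - 1)))
    \<le> real (max_edges_no_regular k r n)"
proof -
  define s where "s = n div k"
  define D where "D = (k - 1) * (r - 1)"
  define \<beta> where "\<beta> = real r / real D"
  have "1 * 1 \<le> D" unfolding D_def using k r by (intro mult_le_mono) auto
  then have D1: "D \<ge> 1" by simp
  have Dr: "real D = (real k - 1) * (real r - 1)" using k r by (simp add: D_def of_nat_diff)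
  have \<beta>_def': "\<beta> = real r / ((real r - 1) * (real k - 1))" by (simp add: \<beta>_def Dr mult.commute)
  have "1 * (real r - 1) \<le> (real k - 1) * (real r - 1)" using k r by (intro mult_right_mono) auto
  then have "real r - 1 \<le> real D" by (simp add: Dr)
  moreover have "2 \<le> real r" using r by simp
  ultimately have "real r \<le> 2 * real D" by linarith
  then have \<beta>2: "\<beta> \<le> 2" using D1 by (simp add: \<beta>_def divide_le_eq)
  have \<beta>_ge: "1 / (real k - 1) \<le> \<beta>"
  proof -
    have "1 / (real k - 1) = (real r - 1) / ((real r - 1) * (real k - 1))" using r by simp
    also have "\<dots> \<le> \<beta>" unfolding \<beta>_def' using k r by (intro divide_right_mono) auto
    finally show ?thesis .
  qed
  have \<beta>0: "\<beta> > 0" using r D1 by (simp add: \<beta>_def)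
  have s1: "s \<ge> 1" using k kn by (simp add: s_def div_greater_zero_iff Suc_le_eq)
  have ns: "n \<le> 2 * k * s"
  proof -
    have "n < (s + 1) * k" unfolding s_def using dividend_less_div_times[of k n] k by (simp add: algebra_simps)
    also have "\<dots> \<le> (2 * s) * k" using s1 by (intro mult_le_mono1) auto
    finally show ?thesis by (simp add: mult_ac)
  qed
  have nsr: "real n \<le> (2 * real k) * real s" using of_nat_mono[OF ns, where 'a = real] by simp
  have k2: "1 \<le> 2 * real k" using k by simp
  have powle: "(2 * real k) powr x \<le> 4 * real k ^ 2" if "x \<le> 2" for x
  proof -
    have "(2 * real k) powr x \<le> (2 * real k) powr 2" using k2 that by (intro powr_mono) auto
    also have "\<dots> = 4 * real k ^ 2" using k by (simp add: power_mult_distrib)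
    finally show ?thesis .
  qed
  have \<theta>: "\<theta> > 0" using k by (simp add: \<theta>_def)
  \<comment> \<open>The real value of \<open>a\<close>: up to \<open>\<theta>\<close> it solves
    \<open>a ^ D * s ^ (k - 1) = r ^ r * s ^ (r * (k - 2))\<close>.\<close>
  define \<alpha> where "\<alpha> = \<theta> * (real r powr \<beta> * real s powr (1 - \<beta>))"
  have \<alpha>0: "\<alpha> \<ge> 0" using \<theta> by (simp add: \<alpha>_def)
  define target where "target = real r powr (1 / (real k - 1)) * real n powr (2 - \<beta>)"
  have target: "target \<le> 4 * real k ^ 2 * real s * \<alpha> / \<theta>"
  proof -
    have "real r powr (1 / (real k - 1)) \<le> real r powr \<beta>" using r \<beta>_ge by (intro powr_mono) auto
    moreover have "real n powr (2 - \<beta>) \<le> 4 * real k ^ 2 * real s powr (2 - \<beta>)"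
    proof -
      have "real n powr (2 - \<beta>) \<le> ((2 * real k) * real s) powr (2 - \<beta>)"
        using nsr \<beta>2 by (intro powr_mono2) auto
      also have "\<dots> = (2 * real k) powr (2 - \<beta>) * real s powr (2 - \<beta>)" by (rule powr_mult)
      also have "\<dots> \<le> 4 * real k ^ 2 * real s powr (2 - \<beta>)" using powle[of "2 - \<beta>"] \<beta>0 by (intro mult_right_mono) auto
      finally show ?thesis .
    qed
    ultimately have "target \<le> real r powr \<beta> * (4 * real k ^ 2 * real s powr (2 - \<beta>))"
      unfolding target_def by (intro mult_mono) auto
    also have "real s powr (2 - \<beta>) = real s * real s powr (1 - \<beta>)"
      using s1 powr_add[of "real s" 1 "1 - \<beta>"] by simp
    finally show ?thesis using \<theta> by (simp add: \<alpha>_def mult_ac)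
  qed
  \<comment> \<open>Here \<open>r \<le> n\<close> enters: \<open>r powr \<beta>\<close> is at most
    \<open>4 * k\<^sup>2 * s powr \<beta>\<close>, so \<open>a\<close> fits below
    \<open>T = s div (16 * k\<^sup>2)\<close>.\<close>
  have \<alpha>_le: "\<alpha> \<le> real s / (16 * real k ^ 2)"
  proof -
    have "real r powr \<beta> \<le> ((2 * real k) * real s) powr \<beta>"
      using nsr r \<beta>0 by (intro powr_mono2) auto
    also have "\<dots> = (2 * real k) powr \<beta> * real s powr \<beta>" by (rule powr_mult)
    also have "\<dots> \<le> 4 * real k ^ 2 * real s powr \<beta>" using powle[OF \<beta>2] by (intro mult_right_mono) auto
    finally have "\<alpha> \<le> \<theta> * ((4 * real k ^ 2 * real s powr \<beta>) * real s powr (1 - \<beta>))"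
      unfolding \<alpha>_def using \<theta> by (intro mult_left_mono mult_right_mono) auto
    also have "\<dots> = \<theta> * (4 * real k ^ 2) * (real s powr \<beta> * real s powr (1 - \<beta>))" by simp
    also have "real s powr \<beta> * real s powr (1 - \<beta>) = real s" using s1 by (simp flip: powr_add)
    also have "\<theta> * (4 * real k ^ 2) * real s \<le> 1 / (16 * real k ^ 2) * real s"
    proof (rule mult_right_mono)
      have "\<theta> * (4 * real k ^ 2) = 4 / (46656 * real k ^ 2)"
        using k by (simp add: \<theta>_def power4_eq_xxxx power2_eq_square field_simps)
      also have "\<dots> \<le> 1 / (16 * real k ^ 2)" using k by (simp add: field_simps)
      finally show "\<theta> * (4 * real k ^ 2) \<le> 1 / (16 * real k ^ 2)" .
    qed simp
    finally show ?thesis by simp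
  qed
  have "\<theta> / (512 * real k ^ 4) * target \<le> \<theta> / (512 * real k ^ 4) * (4 * real k ^ 2 * real s * \<alpha> / \<theta>)"
    using target \<theta> by (intro mult_left_mono) auto
  also have "\<dots> = real s * \<alpha> / (128 * real k ^ 2)"
    using \<theta> k by (simp add: field_simps power4_eq_xxxx power2_eq_square)
  finally have goal: "\<theta> / (512 * real k ^ 4) * target \<le> real s * \<alpha> / (128 * real k ^ 2)" .
  have "real s * \<alpha> / (128 * real k ^ 2) \<le> real (max_edges_no_regular k r n)"
  proof (cases "\<alpha> < 1")
    case True
    have "1 \<le> real k ^ 2" using k by (intro one_le_power) simp
    then have "1 \<le> 128 * real k ^ 2" by linarith
    then have "real s * \<alpha> / (128 * real k ^ 2) \<le> real s * 1 / 1"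
      using True \<alpha>0 by (intro frac_le mult_left_mono) auto
    also have "\<dots> \<le> real (max_edges_no_regular k r n)"
      using div_le_max_edges[of k r n] k r by (simp add: s_def)
    finally show ?thesis .
  next
    case False
    define a where "a = nat \<lfloor>\<alpha>\<rfloor>"
    define T where "T = s div (16 * k\<^sup>2)"
    have a_le: "real a \<le> \<alpha>" using \<alpha>0 by (simp add: a_def)
    have a1: "a \<ge> 1" using False by (simp add: a_def le_nat_iff)
    have a_ge: "\<alpha> \<le> 2 * real a"
    proof -
      have "\<alpha> < real a + 1" using \<alpha>0 by (simp add: a_def)
      then show ?thesis using a1 by linarith
    qed
    have "real a * (16 * real k ^ 2) \<le> real s"
    proof -
      have "real a \<le> real s / (16 * real k ^ 2)" using a_le \<alpha>_le by linarith
      then show ?thesis using k by (simp add: field_simps)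
    qed
    then have "real (a * (16 * k\<^sup>2)) \<le> real s" by simp
    then have "a * (16 * k\<^sup>2) \<le> s" by (simp only: of_nat_le_iff)
    then have aT: "a \<le> T" unfolding T_def using k by (simp add: less_eq_div_iff_mult_less_eq)
    have T: "16 * k\<^sup>2 * T \<le> s" unfolding T_def by (metis mult.commute div_times_less_eq_dividend)
    have T_ge: "s \<le> 32 * k\<^sup>2 * T"
    proof -
      have "s < (T + 1) * (16 * k\<^sup>2)"
        unfolding T_def using dividend_less_div_times[of "16 * k\<^sup>2" s] k by (simp add: algebra_simps)
      also have "\<dots> \<le> (2 * T) * (16 * k\<^sup>2)" using a1 aT by (intro mult_le_mono1) auto
      finally show ?thesis by (simp add: mult_ac)
    qed
    have small: "4 * 3 ^ (k + r) * a ^ ((k - 1) * (r - 1)) * s ^ (k - 1) \<le> r ^ r * s ^ (r * (k - 2))"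
    proof -
      \<comment> \<open>The \<open>D\<close>-th power of \<open>\<theta>\<close> beats
        \<open>4 * 3 ^ (k + r)\<close> because \<open>4 \<le> 3\<^sup>2\<close> and
        \<open>k + r + 2 \<le> 6 * D\<close>.\<close>
      have const: "4 * 3 ^ (k + r) * \<theta> ^ D \<le> 1"
      proof -
        have "\<theta> \<le> 1 / 3 ^ 6"
        proof -
          have "1 \<le> real k ^ 4" using k by (intro one_le_power) simp
          then have "3 ^ 6 \<le> 46656 * real k ^ 4" by simp
          then show ?thesis using k unfolding \<theta>_def by (intro divide_left_mono) auto
        qed
        then have "\<theta> ^ D \<le> (1 / 3 ^ 6) ^ D" using \<theta> by (intro power_mono) auto
        also have "\<dots> = 1 / 3 ^ (6 * D)" by (simp add: power_divide power_mult)
        finally have "4 * 3 ^ (k + r) * \<theta> ^ D \<le> 4 * 3 ^ (k + r) * (1 / 3 ^ (6 * D))"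
          by (intro mult_left_mono) auto
        also have "\<dots> = (4 * 3 ^ (k + r)) / 3 ^ (6 * D)" by simp
        also have "\<dots> \<le> 3 ^ (k + r + 2) / 3 ^ (6 * D)"
          by (intro divide_right_mono) (auto simp: power_add)
        also have "\<dots> \<le> 1"
        proof -
          obtain x y where xy: "k = x + 2" "r = y + 2" using k r by (metis add.commute le_Suc_ex)
          have "k + r + 2 \<le> 6 * D" unfolding D_def xy by (simp add: algebra_simps)
          then have "(3::real) ^ (k + r + 2) \<le> 3 ^ (6 * D)" by (intro power_increasing) auto
          then show ?thesis by simp
        qed
        finally show ?thesis .
      qed
      have "real a ^ D \<le> \<alpha> ^ D" using a_le by (intro power_mono) auto
      also have "\<dots> = \<theta> ^ D * ((real r powr \<beta>) ^ D * (real s powr (1 - \<beta>)) ^ D)"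
        by (simp add: \<alpha>_def power_mult_distrib)
      also have "(real r powr \<beta>) ^ D = real r ^ r"
        using r D1 by (simp add: \<beta>_def powr_powr flip: powr_realpow)
      also have "(real s powr (1 - \<beta>)) ^ D = real s powr (real D - real r)"
      proof -
        have "(real s powr (1 - \<beta>)) ^ D = real s powr ((1 - \<beta>) * real D)"
          using s1 by (simp add: powr_powr flip: powr_realpow)
        also have "(1 - \<beta>) * real D = real D - real r" using D1 by (simp add: \<beta>_def field_simps)
        finally show ?thesis .
      qed
      finally have aD: "real a ^ D \<le> \<theta> ^ D * (real r ^ r * real s powr (real D - real r))" .
      have sexp: "real s powr (real D - real r) * real s ^ (k - 1) = real s ^ (r * (k - 2))"
      proof -
        have "real D - real r + real (k - 1) = real (r * (k - 2))"
          using k r by (simp add: Dr of_nat_diff algebra_simps)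
        then have "real s powr (real D - real r) * real s powr real (k - 1) = real s powr real (r * (k - 2))"
          by (simp flip: powr_add)
        then show ?thesis using s1 by (simp add: powr_realpow del: of_nat_mult)
      qed
      have "4 * 3 ^ (k + r) * real a ^ D * real s ^ (k - 1)
          \<le> 4 * 3 ^ (k + r) * (\<theta> ^ D * (real r ^ r * real s powr (real D - real r))) * real s ^ (k - 1)"
        using aD by (intro mult_right_mono mult_left_mono) auto
      also have "\<dots> = (4 * 3 ^ (k + r) * \<theta> ^ D) * (real r ^ r * (real s powr (real D - real r) * real s ^ (k - 1)))"
        by (simp only: mult_ac)
      also have "\<dots> \<le> 1 * (real r ^ r * (real s powr (real D - real r) * real s ^ (k - 1)))"
        using const by (intro mult_right_mono) auto
      also have "\<dots> = real r ^ r * real s ^ (r * (k - 2))" by (simp only: sexp mult_1)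
      finally have "real (4 * 3 ^ (k + r) * a ^ D * s ^ (k - 1)) \<le> real (r ^ r * s ^ (r * (k - 2)))" by simp
      then show ?thesis unfolding D_def by (simp only: of_nat_le_iff)
    qed
    obtain E where E: "uniform_hypergraph k {..<k * s} E" "linear_hypergraph E"
      "\<not> has_regular_subhypergraph r E" "a * T \<le> 2 * card E"
      using exists_linear_hypergraph_without_regular[OF k r(1) a1 aT T small] by blast
    have "k * s \<le> n" by (simp add: s_def)
    then have "uniform_hypergraph k {..<n} E" using E(1) unfolding uniform_hypergraph_def by fastforce
    then have "card E \<le> max_edges_no_regular k r n" using E by (intro card_le_max_edges)
    then have "a * T \<le> 2 * max_edges_no_regular k r n" using E(4) by linarith
    then have "real (a * T) \<le> real (2 * max_edges_no_regular k r n)" by (rule of_nat_mono)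
    then have f: "real a * real T \<le> 2 * real (max_edges_no_regular k r n)" by simp
    have "real s \<le> real (32 * k\<^sup>2 * T)" using T_ge by (rule of_nat_mono)
    then have "real s * \<alpha> \<le> (32 * real k ^ 2 * real T) * (2 * real a)"
      using a_ge \<alpha>0 by (intro mult_mono) auto
    also have "\<dots> = 64 * real k ^ 2 * (real a * real T)" by simp
    also have "\<dots> \<le> 64 * real k ^ 2 * (2 * real (max_edges_no_regular k r n))"
      using f by (intro mult_left_mono) auto
    finally show ?thesis using k by (simp add: field_simps)
  qed
  then show ?thesis using goal unfolding target_def \<beta>_def' by (simp add: mult.assoc)
qed

text \<open>The guard \<open>k \<le> n\<close> belongs to the lower bound only: for
  \<open>n < k\<close> no edge of size \<open>k\<close> exists, whereas the lower expression is
  positive.\<close>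

theorem theorem1p3:
  fixes k :: nat
  assumes "k \<ge> 2"
  shows "\<exists>C\<^sub>0 C\<^sub>1 C\<^sub>2 :: real. C\<^sub>0 > 0 \<and> C\<^sub>1 > 0 \<and> C\<^sub>2 > 0 \<and>
    (\<forall>r n :: nat. 2 \<le> r \<longrightarrow> r \<le> n \<longrightarrow>
      (k \<le> n \<longrightarrow>
        C\<^sub>0 * real r powr (1 / (real k - 1))
           * real n powr (2 - real r / ((real r - 1) * (real k - 1)))
        \<le> real (max_edges_no_regular k r n)) \<and>
      real (max_edges_no_regular k r n)
        \<le> C\<^sub>1 * real r powr (1 / (real k - 1))
             * real n powr (2 - 1 / (real k - 1)) * ln (real n) powr C\<^sub>2)"
proof (intro exI conjI allI impI)
  show "0 < 1 / (46656 * real k ^ 4) / (512 * real k ^ 4)" using assms by simp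
  show "0 < (64 * real k * (24 * real k) ^ (k - 1) * 4 ^ (k + 2)) powr (1 / (real k - 1))" using assms by simp
  show "0 < real (k + 2) / (real k - 1)" using assms by simp
  fix r n :: nat
  assume r: "2 \<le> r" "r \<le> n"
  show "1 / (46656 * real k ^ 4) / (512 * real k ^ 4) * real r powr (1 / (real k - 1))
      * real n powr (2 - real r / ((real r - 1) * (real k - 1))) \<le> real (max_edges_no_regular k r n)"
    if "k \<le> n" using max_edges_lower_bound[OF assms r that] .
  show "real (max_edges_no_regular k r n)
      \<le> (64 * real k * (24 * real k) ^ (k - 1) * 4 ^ (k + 2)) powr (1 / (real k - 1))
         * real r powr (1 / (real k - 1)) * real n powr (2 - 1 / (real k - 1))
         * ln (real n) powr (real (k + 2) / (real k - 1))"
    by (rule max_edges_upper_bound[OF assms r])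
qed

end
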